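(* Let $\mathcal{F}$ be a nonempty family of graphs with $\chi(\mathcal{F})=r+1\geq 3$, and let $0\leq \alpha\leq 1-\frac{1}{r}$. Then, as $n\to\infty$, $$\mathrm{ex}_{\alpha}(n,\mathcal{F})=\left(1-\frac{1}{r}+o(1)\right)n.$$
   Context: All graphs are finite and simple. For a graph $G$, $A(G)$ is its adjacency matrix, $D(G)$ the diagonal matrix of vertex degrees, and for $0\le\alpha<1$, $A_\alpha(G)=\alpha D(G)+(1-\alpha)A(G)$; the $\alpha$-spectral radius $\lambda_\alpha(G)$ is the largest eigenvalue of $A_\alpha(G)$. For a family $\mathcal{F}$ of graphs, $\chi(\mathcal{F})=\min_{F\in\mathcal{F}}\chi(F)$, where $\chi$ is the chromatic number. A graph is $\mathcal{F}$-free if it contains no member of $\mathcal{F}$ as a (not necessarily induced) subgraph. $\mathrm{ex}_\alpha(n,\mathcal{F})$ denotes the maximum of $\lambda_\alpha(G)$ over all $\mathcal{F}$-free graphs $G$ on $n$ vertices. *)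

theory Defs
  imports Complex_Main
begin

text \<open>A finite simple graph on the vertex set {0..<n}, given as a pair (n, E)
  where E is a symmetric irreflexive set of ordered pairs of vertices.\<close>
type_synonym graph = "nat \<times> (nat \<times> nat) set"

definition verts :: "graph \<Rightarrow> nat set" where
  "verts G = {0..<fst G}"

definition wf_graph :: "graph \<Rightarrow> bool" where
  "wf_graph G \<longleftrightarrow> snd G \<subseteq> verts G \<times> verts G
     \<and> (\<forall>i j. (i, j) \<in> snd G \<longrightarrow> (j, i) \<in> snd G)
     \<and> (\<forall>i. (i, i) \<notin> snd G)"

definition contains :: "graph \<Rightarrow> graph \<Rightarrow> bool" where
  "contains G H \<longleftrightarrow> (\<exists>f. inj_on f (verts H) \<and> f ` verts H \<subseteq> verts G
     \<and> (\<forall>i j. (i, j) \<in> snd H \<longrightarrow> (f i, f j) \<in> snd G))"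

definition free_of :: "graph set \<Rightarrow> graph \<Rightarrow> bool" where
  "free_of \<F> G \<longleftrightarrow> (\<forall>H\<in>\<F>. \<not> contains G H)"

definition proper_colouring :: "graph \<Rightarrow> nat \<Rightarrow> (nat \<Rightarrow> nat) \<Rightarrow> bool" where
  "proper_colouring G c col \<longleftrightarrow> (\<forall>i\<in>verts G. col i < c)
     \<and> (\<forall>i j. (i, j) \<in> snd G \<longrightarrow> col i \<noteq> col j)"

definition chromatic_number :: "graph \<Rightarrow> nat" where
  "chromatic_number G = (LEAST c. \<exists>col. proper_colouring G c col)"

definition family_chromatic_number :: "graph set \<Rightarrow> nat" where
  "family_chromatic_number \<F> = (INF H\<in>\<F>. chromatic_number H)"

definition degree :: "graph \<Rightarrow> nat \<Rightarrow> nat" where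
  "degree G i = card {j \<in> verts G. (i, j) \<in> snd G}"

definition A_alpha :: "real \<Rightarrow> graph \<Rightarrow> nat \<Rightarrow> nat \<Rightarrow> real" where
  "A_alpha \<alpha> G i j = \<alpha> * (if i = j then real (degree G i) else 0)
     + (1 - \<alpha>) * (if (i, j) \<in> snd G then 1 else 0)"

definition is_eigenvalue :: "nat \<Rightarrow> (nat \<Rightarrow> nat \<Rightarrow> real) \<Rightarrow> real \<Rightarrow> bool" where
  "is_eigenvalue n M \<mu> \<longleftrightarrow> (\<exists>x :: nat \<Rightarrow> real. (\<exists>i<n. x i \<noteq> 0)
     \<and> (\<forall>i<n. (\<Sum>j<n. M i j * x j) = \<mu> * x i))"

definition spectral_radius_alpha :: "real \<Rightarrow> graph \<Rightarrow> real" where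
  "spectral_radius_alpha \<alpha> G = Max {\<mu>. is_eigenvalue (fst G) (A_alpha \<alpha> G) \<mu>}"

definition ex_alpha :: "real \<Rightarrow> nat \<Rightarrow> graph set \<Rightarrow> real" where
  "ex_alpha \<alpha> n \<F> = Sup (spectral_radius_alpha \<alpha> `
     {G. wf_graph G \<and> fst G = n \<and> free_of \<F> G})"

end

theory Submission
  imports Defs "HOL-Analysis.Convex" "Jordan_Normal_Form.Spectral_Radius"
begin

text \<open>Lower bound: the complete \<open>r\<close>-partite graph with parts of size \<open>n div r\<close>, padded with
  isolated vertices, is \<open>\<F>\<close>-free and has the eigenvalue \<open>(r - 1) (n div r)\<close>.

  Upper bound: let \<open>\<beta> = 1 - 1/r\<close> and suppose that a graph on \<open>n\<close> vertices has an eigenvalue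
  \<open>\<mu> \<ge> (\<beta> + \<epsilon>) n\<close>. Since \<open>\<alpha> \<le> \<beta>\<close>, the eigenvalue equation forces the absolute values \<open>y\<close> of an
  eigenvector, scaled to average 1, to be at most \<open>1/\<epsilon>\<close>. The form
  \<open>y\<^sup>T A\<^sub>\<alpha> y - \<beta> n |y|\<^sup>2 \<ge> \<epsilon> n\<^sup>2\<close> is a sum over pairs of vertices, so its average over samples of
  \<open>m\<close> random vertices is positive for a suitable constant \<open>m\<close>, whereas it is nonpositive on every
  sample without a clique of size \<open>r + 1\<close> by a Motzkin-Straus argument. As \<open>y\<close> is bounded, a
  positive fraction of all samples contain such a clique, and the box theorem for dense sets of
  tuples yields a complete \<open>(r + 1)\<close>-partite subgraph with parts of any prescribed size,
  hence a copy of a member of \<open>\<F>\<close> with chromatic number \<open>r + 1\<close>.\<close>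

section \<open>Sampling words and the box theorem\<close>

abbreviation words :: "'a set \<Rightarrow> nat \<Rightarrow> 'a list set" where
  "words V k \<equiv> {xs. set xs \<subseteq> V \<and> length xs = k}"

lemma finite_words [simp]: "finite V \<Longrightarrow> finite (words V k)"
  by (rule finite_lists_length_eq)

lemma card_filter_not_eq_sum:
  "finite S \<Longrightarrow> real (card {x \<in> S. \<not> P x}) = (\<Sum>x\<in>S. if P x then 0 else 1)"
  by (simp add: sum.If_cases Int_def)

lemma sum_words_Suc:
  assumes "finite V"
  shows "(\<Sum>xs\<in>words V (Suc k). F xs) = (\<Sum>v\<in>V. \<Sum>ys\<in>words V k. F (v # ys))"
proof -
  have "(\<Sum>xs\<in>words V (Suc k). F xs) = (\<Sum>(ys, v)\<in>words V k \<times> V. F (v # ys))"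
    unfolding lists_length_Suc_eq
    by (subst sum.reindex) (auto simp: inj_on_def intro!: sum.cong)
  also have "\<dots> = (\<Sum>ys\<in>words V k. \<Sum>v\<in>V. F (v # ys))"
    by (rule sum.cartesian_product[symmetric])
  also have "\<dots> = (\<Sum>v\<in>V. \<Sum>ys\<in>words V k. F (v # ys))"
    by (rule sum.swap)
  finally show ?thesis .
qed

text \<open>A single letter of a uniformly random word is uniform on \<open>V\<close>. The factor
  \<open>card V\<close> on the left avoids a division and the exponent \<open>k - 1\<close>.\<close>

lemma sum_words_nth:
  fixes h :: "'a \<Rightarrow> real"
  assumes "finite V" "a < k"
  shows "real (card V) * (\<Sum>xs\<in>words V k. h (xs ! a)) = real (card V) ^ k * (\<Sum>v\<in>V. h v)"
  using assms(2)
proof (induction k arbitrary: a)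
  case (Suc k)
  show ?case
  proof (cases a)
    case 0
    then show ?thesis
      by (simp add: sum_words_Suc assms(1) card_lists_length_eq flip: sum_distrib_left)
  next
    case (Suc b)
    then show ?thesis
      using Suc.prems Suc.IH[of b]
      by (simp add: sum_words_Suc assms(1) algebra_simps)
  qed
qed simp

text \<open>Letters at two different positions are independent and uniform. The induction peels off
  the first letter, hence the auxiliary case \<open>a < b\<close>; the other order follows by
  swapping the arguments of \<open>g\<close>.\<close>

lemma sum_words_nth_nth:
  fixes g :: "'a \<Rightarrow> 'a \<Rightarrow> real"
  assumes "finite V" "a < k" "b < k" "a \<noteq> b"
  shows "real (card V) ^ 2 * (\<Sum>xs\<in>words V k. g (xs ! a) (xs ! b))
    = real (card V) ^ k * (\<Sum>u\<in>V. \<Sum>v\<in>V. g u v)"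
proof -
  have less: "real (card V) ^ 2 * (\<Sum>xs\<in>words V k. g (xs ! a) (xs ! b))
    = real (card V) ^ k * (\<Sum>u\<in>V. \<Sum>v\<in>V. g u v)"
    if "a < b" "b < k" for a b k and g :: "'a \<Rightarrow> 'a \<Rightarrow> real"
    using that
  proof (induction k arbitrary: a b)
    case (Suc k)
    then obtain b' where b': "b = Suc b'" "b' < k"
      by (cases b) auto
    show ?case
    proof (cases a)
      case 0
      have "real (card V) ^ 2 * (\<Sum>xs\<in>words V (Suc k). g (xs ! a) (xs ! b))
        = real (card V) * (\<Sum>u\<in>V. real (card V) * (\<Sum>ys\<in>words V k. g u (ys ! b')))"
        by (simp add: sum_words_Suc assms(1) 0 b' power2_eq_square sum_distrib_left mult.assoc)
      also have "\<dots> = real (card V) * (\<Sum>u\<in>V. real (card V) ^ k * (\<Sum>v\<in>V. g u v))"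
        using sum_words_nth[OF assms(1) b'(2)] by simp
      finally show ?thesis
        by (simp add: sum_distrib_left mult.assoc)
    next
      case (Suc a')
      then show ?thesis
        using Suc.prems Suc.IH[of a' b'] b'
        by (simp add: sum_words_Suc assms(1) algebra_simps)
    qed
  qed simp
  show ?thesis
  proof (cases "a < b")
    case False
    then show ?thesis
      using less[of b a k "\<lambda>u v. g v u"] assms sum.swap[of g V V] by simp
  qed (use less assms in auto)
qed

text \<open>Union bound: two given positions carry the same letter with probability
  \<open>1 / card V\<close>, and there are at most \<open>t ^ 2\<close> ordered pairs of
  positions.\<close>

lemma card_not_distinct_words_le:
  assumes "finite V"
  shows "real (card V) * real (card {xs \<in> words V t. \<not> distinct xs}) \<le> real t ^ 2 * real (card V) ^ t"
proof (cases "V = {}")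
  case False
  define n where "n = real (card V)"
  have n: "n > 0"
    using False assms by (simp add: n_def card_gt_0_iff)
  define P where "P = {(a, b). a < t \<and> b < t \<and> a \<noteq> b}"
  have P: "finite P" "card P \<le> t ^ 2"
  proof -
    have sub: "P \<subseteq> {..<t} \<times> {..<t}"
      by (auto simp: P_def)
    then show "finite P"
      by (rule finite_subset) simp
    show "card P \<le> t ^ 2"
      using card_mono[OF _ sub] by (simp add: power2_eq_square)
  qed
  define e :: "'a \<Rightarrow> 'a \<Rightarrow> real" where "e = (\<lambda>u v. if u = v then 1 else 0)"
  have "real (card {xs \<in> words V t. \<not> distinct xs}) = (\<Sum>xs\<in>words V t. if distinct xs then 0 else 1)"
    by (rule card_filter_not_eq_sum[OF finite_words[OF assms]])
  also have "\<dots> \<le> (\<Sum>xs\<in>words V t. \<Sum>(a, b)\<in>P. e (xs ! a) (xs ! b))"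
  proof (rule sum_mono)
    fix xs assume xs: "xs \<in> words V t"
    have nonneg: "0 \<le> (\<Sum>(a, b)\<in>P. e (xs ! a) (xs ! b))"
      by (intro sum_nonneg) (auto simp: e_def)
    show "(if distinct xs then 0 else 1) \<le> (\<Sum>(a, b)\<in>P. e (xs ! a) (xs ! b))"
    proof (cases "distinct xs")
      case False
      then obtain a b where ab: "a < t" "b < t" "a \<noteq> b" "xs ! a = xs ! b"
        using xs by (auto simp: distinct_conv_nth)
      have "1 = e (xs ! a) (xs ! b)"
        using ab by (simp add: e_def)
      also have "\<dots> \<le> (\<Sum>(a, b)\<in>P. e (xs ! a) (xs ! b))"
        using member_le_sum[of "(a, b)" P "\<lambda>(a, b). e (xs ! a) (xs ! b)"] ab P(1)
        by (auto simp: P_def e_def)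
      finally show ?thesis
        using False by simp
    qed (use nonneg in simp)
  qed
  also have "\<dots> = (\<Sum>(a, b)\<in>P. \<Sum>xs\<in>words V t. e (xs ! a) (xs ! b))"
    by (subst sum.swap) (simp add: case_prod_unfold)
  finally have "n ^ 2 * real (card {xs \<in> words V t. \<not> distinct xs})
      \<le> (\<Sum>(a, b)\<in>P. n ^ 2 * (\<Sum>xs\<in>words V t. e (xs ! a) (xs ! b)))"
    using n by (simp add: sum_distrib_left case_prod_unfold flip: sum_distrib_left)
  also have "\<dots> = (\<Sum>(a, b)\<in>P. n ^ t * n)"
  proof (rule sum.cong[OF refl], clarify)
    fix a b assume "(a, b) \<in> P"
    then show "n ^ 2 * (\<Sum>xs\<in>words V t. e (xs ! a) (xs ! b)) = n ^ t * n"
      using sum_words_nth_nth[OF assms, of a t b e] assms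
      by (simp add: P_def n_def) (simp add: e_def)
  qed
  also have "\<dots> \<le> real t ^ 2 * (n ^ t * n)"
    using P(2) n by (simp add: mult_right_mono flip: of_nat_power)
  finally have "n * (n * real (card {xs \<in> words V t. \<not> distinct xs})) \<le> n * (real t ^ 2 * n ^ t)"
    by (simp add: power2_eq_square mult_ac)
  then show ?thesis
    using n by (simp add: n_def)
qed simp

text \<open>Power mean inequality: \<open>x ^ t\<close> lies above its tangent at
  \<open>x = c\<close>, which is Bernoulli's inequality for \<open>x / c - 1\<close>. Summing the
  tangents uses only the lower bound on the sum of the values.\<close>

lemma sum_power_ge:
  fixes x :: "'a \<Rightarrow> real"
  assumes "finite Y" "c > 0" "\<And>y. y \<in> Y \<Longrightarrow> 0 \<le> x y" "c * real (card Y) \<le> (\<Sum>y\<in>Y. x y)"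
  shows "c ^ t * real (card Y) \<le> (\<Sum>y\<in>Y. x y ^ t)"
proof -
  have "c ^ t + c ^ t * (real t * (x y / c - 1)) \<le> x y ^ t" if "y \<in> Y" for y
  proof -
    have "1 + real t * (x y / c - 1) \<le> (1 + (x y / c - 1)) ^ t"
      using assms that by (intro Bernoulli_inequality) simp
    then have "c ^ t * (1 + real t * (x y / c - 1)) \<le> c ^ t * (x y / c) ^ t"
      using assms(2) by (intro mult_left_mono) auto
    then show ?thesis
      using assms(2) by (simp add: power_divide distrib_left)
  qed
  then have "(\<Sum>y\<in>Y. c ^ t + c ^ t * (real t * (x y / c - 1))) \<le> (\<Sum>y\<in>Y. x y ^ t)"
    by (rule sum_mono)
  moreover have "(\<Sum>y\<in>Y. c ^ t + c ^ t * (real t * (x y / c - 1)))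
      = c ^ t * real (card Y) + c ^ t * (real t * ((\<Sum>y\<in>Y. x y) / c - real (card Y)))"
    by (simp add: sum.distrib sum_subtractf sum_divide_distrib flip: sum_distrib_left)
  moreover have "(\<Sum>y\<in>Y. x y) / c - real (card Y) \<ge> 0"
    using assms(2,4) by (simp add: field_simps)
  then have "c ^ t * (real t * ((\<Sum>y\<in>Y. x y) / c - real (card Y))) \<ge> 0"
    using assms(2) by (intro mult_nonneg_nonneg) auto
  ultimately show ?thesis
    by linarith
qed

text \<open>Erdos' box theorem, by induction on the number of coordinates: some \<open>t\<close> values of the first
  coordinate have many continuations in common, since by convexity this already holds on average
  and only few words of length \<open>t\<close> have a repeated letter.\<close>

lemma dense_words_contain_box:
  fixes c :: real
  assumes "c > 0"
  shows "\<exists>N. \<forall>V T. finite V \<longrightarrow> card V \<ge> N \<longrightarrow> T \<subseteq> words (V :: 'a set) k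
    \<longrightarrow> c * real (card V) ^ k \<le> real (card T)
    \<longrightarrow> (\<exists>Bs. length Bs = k \<and> (\<forall>B\<in>set Bs. B \<subseteq> V \<and> card B = t) \<and> listset Bs \<subseteq> T)"
  using assms
proof (induction k arbitrary: c)
  case 0
  show ?case
  proof (intro exI[of _ 0] allI impI)
    fix V :: "'a set" and T
    assume "T \<subseteq> words V 0" "c * real (card V) ^ 0 \<le> real (card T)"
    then have "T \<noteq> {}" "T \<subseteq> {[]}"
      using 0 by auto
    then have "T = {[]}"
      by auto
    then show "\<exists>Bs. length Bs = 0 \<and> (\<forall>B\<in>set Bs. B \<subseteq> V \<and> card B = t) \<and> listset Bs \<subseteq> T"
      by (intro exI[of _ "[]"]) auto
  qed
next
  case (Suc k)
  \<comment> \<open>On average a word of length \<open>t\<close> has at least a proportion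
    \<open>c ^ t\<close> of common continuations. One half is kept as the new density, the other
    half pays for words with repeated letters.\<close>
  define c' where "c' = c ^ t / 2"
  have c': "c' > 0"
    using Suc.prems by (simp add: c'_def)
  from Suc.IH[OF c'] obtain N where N: "\<And>V T. finite V \<Longrightarrow> card V \<ge> N \<Longrightarrow> T \<subseteq> words (V :: 'a set) k
    \<Longrightarrow> c' * real (card V) ^ k \<le> real (card T)
    \<Longrightarrow> \<exists>Bs. length Bs = k \<and> (\<forall>B\<in>set Bs. B \<subseteq> V \<and> card B = t) \<and> listset Bs \<subseteq> T"
    by blast
  \<comment> \<open>From \<open>N'\<close> on, the proportion of words of length \<open>t\<close>
    with a repeated letter, at most \<open>t ^ 2 / n\<close>, is below \<open>c'\<close>.\<close>
  obtain N' :: nat where N': "real N' > real t ^ 2 / c'"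
    using reals_Archimedean2 by blast
  show ?case
  proof (intro exI[of _ "max N (max 1 N')"] allI impI)
    fix V :: "'a set" and T
    assume V: "finite V" and card_V: "card V \<ge> max N (max 1 N')" and T: "T \<subseteq> words V (Suc k)"
      and card_T: "c * real (card V) ^ Suc k \<le> real (card T)"
    define n where "n = real (card V)"
    have n: "n > 0" "n \<ge> real N'"
      using card_V by (auto simp: n_def)
    define D where "D ys = {v \<in> V. v # ys \<in> T}" for ys
    define F where "F b = {ys \<in> words V k. \<forall>v\<in>set b. v # ys \<in> T}" for b
    have sum_D: "real (card T) = (\<Sum>ys\<in>words V k. real (card (D ys)))"
    proof -
      have "real (card T) = (\<Sum>xs\<in>words V (Suc k). if xs \<in> T then 1 else 0)"
        using T V by (simp add: sum.If_cases Int_absorb1)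
      also have "\<dots> = (\<Sum>ys\<in>words V k. \<Sum>v\<in>V. if v # ys \<in> T then 1 else 0)"
        by (simp only: sum_words_Suc[OF V]) (rule sum.swap)
      also have "\<dots> = (\<Sum>ys\<in>words V k. real (card (D ys)))"
        using V by (simp add: sum.If_cases D_def Int_def)
      finally show ?thesis .
    qed
    have card_words: "real (card (words V k)) = n ^ k"
      using V by (simp add: card_lists_length_eq n_def)
    have "(c * n) ^ t * n ^ k \<le> (\<Sum>ys\<in>words V k. real (card (D ys)) ^ t)"
      using sum_power_ge[of "words V k" "c * n" "\<lambda>ys. real (card (D ys))" t] V n Suc.prems
        card_T sum_D card_words by (simp add: n_def mult_ac)
    \<comment> \<open>Double counting: the power counts the words \<open>b\<close> all of whose
      letters extend \<open>ys\<close> to a member of \<open>T\<close>, that is, those with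
      \<open>ys\<close> in \<open>F b\<close>.\<close>
    also have "\<dots> = (\<Sum>ys\<in>words V k. \<Sum>b\<in>words V t. if ys \<in> F b then 1 else 0)"
    proof (rule sum.cong[OF refl])
      fix ys assume ys: "ys \<in> words V k"
      have "words (D ys) t = {b \<in> words V t. ys \<in> F b}"
        using ys by (auto simp: D_def F_def)
      moreover have "real (card (words (D ys) t)) = real (card (D ys)) ^ t"
        using V by (simp add: card_lists_length_eq D_def)
      ultimately show "real (card (D ys)) ^ t = (\<Sum>b\<in>words V t. if ys \<in> F b then 1 else 0)"
        using V by (simp add: sum.If_cases Int_def)
    qed
    also have "\<dots> = (\<Sum>b\<in>words V t. \<Sum>ys\<in>words V k. if ys \<in> F b then 1 else 0)"
      by (rule sum.swap)
    also have "\<dots> = (\<Sum>b\<in>words V t. real (card (F b)))"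
    proof (rule sum.cong[OF refl])
      fix b
      have "words V k \<inter> F b = F b"
        by (auto simp: F_def)
      then show "(\<Sum>ys\<in>words V k. if ys \<in> F b then 1 else 0) = real (card (F b))"
        using V by (simp add: sum.If_cases Int_def)
    qed
    finally have lower: "(c * n) ^ t * n ^ k \<le> (\<Sum>b\<in>words V t. real (card (F b)))" .
    have "\<exists>b\<in>words V t. distinct b \<and> c' * n ^ k \<le> real (card (F b))"
    proof (rule ccontr)
      assume "\<not> ?thesis"
      then have small: "real (card (F b)) < c' * n ^ k" if "b \<in> words V t" "distinct b" for b
        using that by force
      have le: "real (card (F b)) \<le> n ^ k" for b
      proof -
        have "card (F b) \<le> card (words V k)"
          using V by (intro card_mono) (auto simp: F_def)
        then show ?thesis
          using card_words by linarith
      qed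
      have "(\<Sum>b\<in>words V t. real (card (F b)))
          \<le> (\<Sum>b\<in>words V t. c' * n ^ k + (if distinct b then 0 else 1) * n ^ k)"
      proof (rule sum_mono)
        fix b assume "b \<in> words V t"
        moreover have "0 \<le> c' * n ^ k"
          using c' n by simp
        ultimately show "real (card (F b)) \<le> c' * n ^ k + (if distinct b then 0 else 1) * n ^ k"
          using small[of b] le[of b] by auto
      qed
      also have "\<dots> = n ^ t * (c' * n ^ k) + real (card {b \<in> words V t. \<not> distinct b}) * n ^ k"
        unfolding card_filter_not_eq_sum[OF finite_words[OF V]] sum.distrib sum_distrib_right[symmetric]
        using V by (simp add: card_lists_length_eq n_def)
      finally have "(c * n) ^ t * n ^ k
          \<le> n ^ t * (c' * n ^ k) + real (card {b \<in> words V t. \<not> distinct b}) * n ^ k"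
        using lower by linarith
      \<comment> \<open>Multiplying by \<open>n\<close> allows the bound on words with repetitions
        to be inserted without division.\<close>
      then have "n * ((c * n) ^ t * n ^ k) \<le> n * (n ^ t * (c' * n ^ k)
          + real (card {b \<in> words V t. \<not> distinct b}) * n ^ k)"
        using n by (intro mult_left_mono) auto
      also have "\<dots> = n * (n ^ t * (c' * n ^ k))
          + (n * real (card {b \<in> words V t. \<not> distinct b})) * n ^ k"
        by (simp only: distrib_left mult.assoc)
      also have "\<dots> \<le> n * (n ^ t * (c' * n ^ k)) + (real t ^ 2 * n ^ t) * n ^ k"
        using card_not_distinct_words_le[OF V, of t] n by (simp add: n_def mult_right_mono)
      also have "\<dots> < n * (n ^ t * (c' * n ^ k)) + ((c' * n) * n ^ t) * n ^ k"
      proof -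
        have "real t ^ 2 < c' * n"
          using N' n c' by (metis less_le_trans mult.commute pos_divide_less_eq)
        then show ?thesis
          using n by simp
      qed
      also have "\<dots> = n * ((c * n) ^ t * n ^ k)"
        by (simp add: c'_def power_mult_distrib)
      finally show False
        by simp
    qed
    then obtain b where b: "b \<in> words V t" "distinct b" "c' * n ^ k \<le> real (card (F b))"
      by blast
    have "F b \<subseteq> words V k"
      by (auto simp: F_def)
    then obtain Bs where Bs: "length Bs = k" "\<forall>B\<in>set Bs. B \<subseteq> V \<and> card B = t" "listset Bs \<subseteq> F b"
      using N[OF V, of "F b"] card_V b(3) unfolding n_def by auto
    \<comment> \<open>Since \<open>b\<close> is distinct, its letters form a set of exactly
      \<open>t\<close> elements, which becomes the first side of the box.\<close>
    have "listset (set b # Bs) \<subseteq> T"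
      using Bs(3) by (auto simp: set_Cons_def F_def)
    then show "\<exists>Bs. length Bs = Suc k \<and> (\<forall>B\<in>set Bs. B \<subseteq> V \<and> card B = t) \<and> listset Bs \<subseteq> T"
      using Bs(1,2) b(1,2) by (intro exI[of _ "set b # Bs"]) (auto simp: distinct_card)
  qed
qed

section \<open>The Motzkin-Straus argument\<close>

text \<open>Exhibits the form as a quadratic polynomial in the single weight
  \<open>w u\<close>.\<close>

lemma quadratic_form_insert:
  fixes K :: "'a \<Rightarrow> 'a \<Rightarrow> real"
  assumes "finite J" "u \<notin> J" "\<And>i j. K i j = K j i"
  shows "(\<Sum>i\<in>insert u J. \<Sum>j\<in>insert u J. K i j * w i * w j)
    = (\<Sum>i\<in>J. \<Sum>j\<in>J. K i j * w i * w j) + w u * (2 * (\<Sum>j\<in>J. K u j * w j) + w u * K u u)"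
proof -
  have "(\<Sum>i\<in>J. K i u * w i * w u) = w u * (\<Sum>j\<in>J. K u j * w j)"
    by (simp add: sum_distrib_left assms(3)[of _ u] mult_ac)
  moreover have "(\<Sum>j\<in>J. K u j * w u * w j) = w u * (\<Sum>j\<in>J. K u j * w j)"
    by (simp add: sum_distrib_left mult_ac)
  ultimately show ?thesis
    using assms(1,2) by (simp add: sum.distrib algebra_simps)
qed

text \<open>The flatness hypothesis makes the form linear in the direction that moves weight between two
  non-adjacent points, so all weight can be pushed to one of them.\<close>

lemma quadratic_form_nonpos_by_cliques:
  fixes K :: "'a \<Rightarrow> 'a \<Rightarrow> real" and w :: "'a \<Rightarrow> real"
  assumes "finite I" "\<And>i j. K i j = K j i"
    and flat: "\<And>u v. u \<in> I \<Longrightarrow> v \<in> I \<Longrightarrow> u \<noteq> v \<Longrightarrow> \<not> R u v \<Longrightarrow> K u u + K v v = 2 * K u v"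
    and clique: "\<And>C w. C \<subseteq> I \<Longrightarrow> \<forall>i\<in>C. \<forall>j\<in>C. i \<noteq> j \<longrightarrow> R i j \<Longrightarrow> \<forall>i. 0 \<le> w i
      \<Longrightarrow> (\<Sum>i\<in>C. \<Sum>j\<in>C. K i j * w i * w j) \<le> 0"
    and "\<forall>i. 0 \<le> w i"
  shows "(\<Sum>i\<in>I. \<Sum>j\<in>I. K i j * w i * w j) \<le> 0"
  using assms(1,3,4,5)
proof (induction "card I" arbitrary: I w rule: less_induct)
  case less
  show ?case
  proof (cases "\<forall>i\<in>I. \<forall>j\<in>I. i \<noteq> j \<longrightarrow> R i j")
    case True
    then show ?thesis
      using less.prems(3)[of I w] less.prems(4) by blast
  next
    case False
    then obtain u v where uv: "u \<in> I" "v \<in> I" "u \<noteq> v" "\<not> R u v"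
      by blast
    define J where "J = I - {u, v}"
    define S where "S a = 2 * (\<Sum>j\<in>J. K a j * w j)" for a
    define s where "s = w u + w v"
    have J: "finite J" "u \<notin> J" "v \<notin> J" "I = insert u (insert v J)"
      using uv less.prems(1) by (auto simp: J_def)
    have flat: "K u v = (K u u + K v v) / 2"
      using less.prems(2)[OF uv] by simp
    have "(\<Sum>i\<in>I. \<Sum>j\<in>I. K i j * w i * w j)
        = (\<Sum>i\<in>J. \<Sum>j\<in>J. K i j * w i * w j) + w v * (S v + w v * K v v)
          + w u * (2 * (K u v * w v) + S u + w u * K u u)"
    proof -
      have "2 * (\<Sum>j\<in>insert v J. K u j * w j) = 2 * (K u v * w v) + S u"
        using J(1,3) by (simp add: S_def)
      moreover have "(\<Sum>i\<in>insert u (insert v J). \<Sum>j\<in>insert u (insert v J). K i j * w i * w j)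
          = (\<Sum>i\<in>insert v J. \<Sum>j\<in>insert v J. K i j * w i * w j)
            + w u * (2 * (\<Sum>j\<in>insert v J. K u j * w j) + w u * K u u)"
        using J uv(3) by (intro quadratic_form_insert assms(2)) auto
      moreover have "(\<Sum>i\<in>insert v J. \<Sum>j\<in>insert v J. K i j * w i * w j)
          = (\<Sum>i\<in>J. \<Sum>j\<in>J. K i j * w i * w j) + w v * (2 * (\<Sum>j\<in>J. K v j * w j) + w v * K v v)"
        using J by (intro quadratic_form_insert assms(2)) auto
      ultimately show ?thesis
        unfolding J(4) by (simp only: S_def)
    qed
    \<comment> \<open>With the total \<open>s\<close> of the two weights held fixed, flatness
      cancels all quadratic terms, so that the expression is linear in the way \<open>s\<close> is
      divided between \<open>u\<close> and \<open>v\<close>.\<close>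
    also have "\<dots> = (\<Sum>i\<in>J. \<Sum>j\<in>J. K i j * w i * w j)
        + (w v * (S v + s * K v v) + w u * (S u + s * K u u))"
      unfolding flat by (simp add: s_def field_simps)
    finally have split: "(\<Sum>i\<in>I. \<Sum>j\<in>I. K i j * w i * w j) = (\<Sum>i\<in>J. \<Sum>j\<in>J. K i j * w i * w j)
        + (w v * (S v + s * K v v) + w u * (S u + s * K u u))" .
    \<comment> \<open>This is the value of the form when \<open>a\<close> receives the whole weight
      \<open>s\<close> and the other point is dropped. The support is then smaller than
      \<open>I\<close>, so the induction hypothesis applies to the modified weights.\<close>
    have bound: "(\<Sum>i\<in>J. \<Sum>j\<in>J. K i j * w i * w j) + s * (S a + s * K a a) \<le> 0"
      if a: "a \<in> {u, v}" for a
    proof -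
      define w' where "w' = w(a := s)"
      have aJ: "a \<notin> J" "insert a J \<subset> I" and w': "\<forall>i. 0 \<le> w' i"
        using J uv a less.prems(4) by (auto simp: w'_def s_def)
      have "(\<Sum>i\<in>insert a J. \<Sum>j\<in>insert a J. K i j * w' i * w' j) \<le> 0"
      proof (rule less.hyps)
        show "card (insert a J) < card I"
          using aJ(2) less.prems(1) by (rule psubset_card_mono[rotated])
        show "finite (insert a J)"
          using J(1) by simp
        show "K b b + K c c = 2 * K b c"
          if "b \<in> insert a J" "c \<in> insert a J" "b \<noteq> c" "\<not> R b c" for b c
          using that aJ(2) by (intro less.prems(2)) auto
        show "(\<Sum>i\<in>C. \<Sum>j\<in>C. K i j * w i * w j) \<le> 0"
          if "C \<subseteq> insert a J" "\<forall>i\<in>C. \<forall>j\<in>C. i \<noteq> j \<longrightarrow> R i j" "\<forall>i. 0 \<le> w i" for C w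
          using that aJ(2) by (intro less.prems(3)) auto
      qed (rule w')
      moreover have "(\<Sum>i\<in>J. \<Sum>j\<in>J. K i j * w' i * w' j) = (\<Sum>i\<in>J. \<Sum>j\<in>J. K i j * w i * w j)"
        using aJ by (intro sum.cong refl) (auto simp: w'_def)
      moreover have "(\<Sum>j\<in>J. K a j * w' j) = (\<Sum>j\<in>J. K a j * w j)"
        using aJ by (intro sum.cong refl) (auto simp: w'_def)
      ultimately show ?thesis
        using quadratic_form_insert[where K=K and J=J and u=a and w=w'] aJ J(1) assms(2)
        by (simp add: S_def w'_def del: sum.insert)
    qed
    have "w v * (S v + s * K v v) + w u * (S u + s * K u u)
        \<le> s * max (S u + s * K u u) (S v + s * K v v)"
    proof -
      have "w v * (S v + s * K v v) \<le> w v * max (S u + s * K u u) (S v + s * K v v)"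
        "w u * (S u + s * K u u) \<le> w u * max (S u + s * K u u) (S v + s * K v v)"
        using less.prems(4) by (auto intro!: mult_left_mono)
      then show ?thesis
        by (simp add: s_def distrib_right)
    qed
    moreover have "(\<Sum>i\<in>J. \<Sum>j\<in>J. K i j * w i * w j)
        + s * max (S u + s * K u u) (S v + s * K v v) \<le> 0"
      using bound[of u] bound[of v] by (auto simp: max_def)
    ultimately show ?thesis
      using split by linarith
  qed
qed

text \<open>On a symmetric \<open>E\<close> over \<open>n\<close> points, the sum of this kernel over all pairs is
  \<open>y\<^sup>T A\<^sub>\<alpha> y - \<beta> n |y|\<^sup>2\<close>.\<close>

definition excess_kernel ::
  "real \<Rightarrow> real \<Rightarrow> ('a \<times> 'a) set \<Rightarrow> ('a \<Rightarrow> real) \<Rightarrow> 'a \<Rightarrow> 'a \<Rightarrow> real" where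
  "excess_kernel \<alpha> \<beta> E y i j =
    (if (i, j) \<in> E then (1 - \<alpha>) * (y i * y j) + \<alpha> * ((y i ^ 2 + y j ^ 2) / 2) else 0)
      - \<beta> * ((y i ^ 2 + y j ^ 2) / 2)"

text \<open>Splitting the squares evenly between the two ends of a pair gives flatness as an exact
  identity.\<close>

lemma excess_kernel_nonadjacent:
  assumes "(i, i) \<notin> E" "(j, j) \<notin> E" "(i, j) \<notin> E"
  shows "excess_kernel \<alpha> \<beta> E y i i + excess_kernel \<alpha> \<beta> E y j j = 2 * excess_kernel \<alpha> \<beta> E y i j"
  using assms by (simp add: excess_kernel_def algebra_simps add_divide_distrib)

text \<open>Since \<alpha> is at most \<beta> = 1 - 1/r, the inequality
  \<open>2ab \<le> a^2 + b^2\<close> bounds the kernel on an edge by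
  \<open>(1 - \<beta>) * (y i * y j)\<close>. What remains is Cauchy-Schwarz for at most
  \<open>r\<close> terms, as \<open>1 - \<beta>\<close> is \<open>1 / r\<close>.\<close>

lemma excess_kernel_clique_nonpos:
  fixes y :: "'a \<Rightarrow> real" and x :: "'b \<Rightarrow> 'a"
  assumes "finite C" "card C \<le> r" "r > 0" "\<alpha> \<le> 1 - 1 / real r" "\<And>i. (i, i) \<notin> E"
    and "\<forall>i\<in>C. \<forall>j\<in>C. i \<noteq> j \<longrightarrow> (x i, x j) \<in> E" "\<And>i. 0 \<le> w i"
  shows "(\<Sum>i\<in>C. \<Sum>j\<in>C. excess_kernel \<alpha> (1 - 1 / real r) E y (x i) (x j) * w i * w j) \<le> 0"
proof -
  define \<beta> where "\<beta> = 1 - 1 / real r"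
  define z where "z i = w i * y (x i)" for i
  have le: "excess_kernel \<alpha> \<beta> E y (x i) (x j) * w i * w j
      \<le> (1 - \<beta>) * (z i * z j) - (if i = j then z i ^ 2 else 0)" if "i \<in> C" "j \<in> C" for i j
  proof (cases "i = j")
    case True
    then show ?thesis
      using assms(5) by (simp add: excess_kernel_def z_def power2_eq_square algebra_simps)
  next
    case False
    have "y (x i) * y (x j) \<le> (y (x i) ^ 2 + y (x j) ^ 2) / 2"
      using zero_le_power2[of "y (x i) - y (x j)"] by (simp add: power2_diff)
    then have "(\<beta> - \<alpha>) * (y (x i) * y (x j)) \<le> (\<beta> - \<alpha>) * ((y (x i) ^ 2 + y (x j) ^ 2) / 2)"
      using assms(4) by (intro mult_left_mono) (auto simp: \<beta>_def)
    then have "excess_kernel \<alpha> \<beta> E y (x i) (x j) \<le> (1 - \<beta>) * (y (x i) * y (x j))"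
      using that False assms(6) by (simp add: excess_kernel_def left_diff_distrib)
    then have "excess_kernel \<alpha> \<beta> E y (x i) (x j) * (w i * w j)
        \<le> (1 - \<beta>) * (y (x i) * y (x j)) * (w i * w j)"
      using assms(7) by (intro mult_right_mono) auto
    then show ?thesis
      using False by (simp add: z_def mult_ac)
  qed
  have "(\<Sum>i\<in>C. \<Sum>j\<in>C. excess_kernel \<alpha> \<beta> E y (x i) (x j) * w i * w j)
      \<le> (\<Sum>i\<in>C. \<Sum>j\<in>C. (1 - \<beta>) * (z i * z j) - (if i = j then z i ^ 2 else 0))"
    using le by (intro sum_mono) auto
  also have "\<dots> = (1 - \<beta>) * (\<Sum>i\<in>C. z i) ^ 2 - (\<Sum>i\<in>C. z i ^ 2)"
    using assms(1)
    by (simp add: sum_subtractf power2_eq_square[of "sum z C"] sum_product)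
       (simp add: sum_distrib_left)
  also have "\<dots> \<le> 0"
  proof -
    have "(\<Sum>i\<in>C. z i) ^ 2 \<le> (\<Sum>i\<in>C. z i ^ 2) * real (card C)"
      by (rule sum_squared_le_sum_of_squares)
    also have "\<dots> \<le> (\<Sum>i\<in>C. z i ^ 2) * real r"
      using assms(2) by (intro mult_left_mono sum_nonneg) auto
    finally show ?thesis
      using assms(3) by (simp add: \<beta>_def divide_le_eq)
  qed
  finally show ?thesis
    by (simp add: \<beta>_def)
qed

text \<open>The index set consists of positions and \<open>x\<close> may repeat points. Equal points
  are non-adjacent because \<open>E\<close> has no loops, so words with repetitions need no separate
  treatment.\<close>

lemma excess_kernel_sum_nonpos:
  fixes y :: "'a \<Rightarrow> real" and x :: "'b \<Rightarrow> 'a"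
  assumes "finite I" "r > 0" "\<alpha> \<le> 1 - 1 / real r" "sym E" "\<And>i. (i, i) \<notin> E"
    and "\<not> (\<exists>C\<subseteq>I. card C = r + 1 \<and> (\<forall>i\<in>C. \<forall>j\<in>C. i \<noteq> j \<longrightarrow> (x i, x j) \<in> E))"
  shows "(\<Sum>i\<in>I. \<Sum>j\<in>I. excess_kernel \<alpha> (1 - 1 / real r) E y (x i) (x j)) \<le> 0"
proof -
  have "(\<Sum>i\<in>I. \<Sum>j\<in>I. excess_kernel \<alpha> (1 - 1 / real r) E y (x i) (x j) * 1 * 1) \<le> 0"
  proof (rule quadratic_form_nonpos_by_cliques[where R = "\<lambda>i j. (x i, x j) \<in> E"])
    show "excess_kernel \<alpha> (1 - 1 / real r) E y (x i) (x j)
        = excess_kernel \<alpha> (1 - 1 / real r) E y (x j) (x i)" for i j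
      using assms(4) by (auto simp: excess_kernel_def sym_def algebra_simps)
  next
    fix u v assume "(x u, x v) \<notin> E"
    then show "excess_kernel \<alpha> (1 - 1 / real r) E y (x u) (x u)
        + excess_kernel \<alpha> (1 - 1 / real r) E y (x v) (x v)
        = 2 * excess_kernel \<alpha> (1 - 1 / real r) E y (x u) (x v)"
      using assms(5) by (intro excess_kernel_nonadjacent)
  next
    fix C and w :: "'b \<Rightarrow> real"
    assume C: "C \<subseteq> I" "\<forall>i\<in>C. \<forall>j\<in>C. i \<noteq> j \<longrightarrow> (x i, x j) \<in> E" and w: "\<forall>i. 0 \<le> w i"
    have "card C \<le> r"
    proof (rule ccontr)
      assume "\<not> card C \<le> r"
      then obtain D where "D \<subseteq> C" "card D = r + 1"
        using obtain_subset_with_card_n[of "r + 1" C] by (metis Suc_eq_plus1 not_less_eq_eq)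
      then show False
        using assms(6) C by (meson subset_trans subsetD)
    qed
    then show "(\<Sum>i\<in>C. \<Sum>j\<in>C. excess_kernel \<alpha> (1 - 1 / real r) E y (x i) (x j) * w i * w j) \<le> 0"
      using excess_kernel_clique_nonpos[OF _ _ assms(2,3,5) C(2)] assms(1) C(1) w
      by (meson finite_subset)
  qed (use assms in auto)
  then show ?thesis
    by simp
qed

section \<open>Eigenvalues and colourings\<close>

text \<open>The generality in the ring serves two purposes: finiteness of the spectrum is taken from
  the real matrix, its nonemptiness from the complex one.\<close>

lemma eigenvalue_mat_iff:
  fixes M :: "nat \<Rightarrow> nat \<Rightarrow> 'a :: comm_ring_1"
  shows "eigenvalue (mat n n (\<lambda>(i, j). M i j)) k
    \<longleftrightarrow> (\<exists>x. (\<exists>i<n. x i \<noteq> 0) \<and> (\<forall>i<n. (\<Sum>j<n. M i j * x j) = k * x i))"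
proof
  assume "eigenvalue (mat n n (\<lambda>(i, j). M i j)) k"
  then obtain v where v: "v \<in> carrier_vec n" "v \<noteq> 0\<^sub>v n"
    "mat n n (\<lambda>(i, j). M i j) *\<^sub>v v = k \<cdot>\<^sub>v v"
    by (auto simp: eigenvalue_def eigenvector_def)
  have "\<exists>i<n. v $ i \<noteq> 0"
    using v(1,2) by (metis carrier_vecD eq_vecI index_zero_vec)
  moreover have "(\<Sum>j<n. M i j * v $ j) = k * v $ i" if "i < n" for i
  proof -
    have "(mat n n (\<lambda>(i, j). M i j) *\<^sub>v v) $ i = (k \<cdot>\<^sub>v v) $ i"
      using v(3) by simp
    then show ?thesis
      using that v(1) by (simp add: scalar_prod_def lessThan_atLeast0)
  qed
  ultimately show "\<exists>x. (\<exists>i<n. x i \<noteq> 0) \<and> (\<forall>i<n. (\<Sum>j<n. M i j * x j) = k * x i)"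
    by (intro exI[of _ "\<lambda>i. v $ i"]) auto
next
  assume "\<exists>x. (\<exists>i<n. x i \<noteq> 0) \<and> (\<forall>i<n. (\<Sum>j<n. M i j * x j) = k * x i)"
  then obtain x i where x: "i < n" "x i \<noteq> 0" "\<forall>i<n. (\<Sum>j<n. M i j * x j) = k * x i"
    by blast
  have "vec n x \<noteq> 0\<^sub>v n"
    using x(1,2) by (metis index_vec index_zero_vec(1))
  moreover have "mat n n (\<lambda>(i, j). M i j) *\<^sub>v vec n x = k \<cdot>\<^sub>v vec n x"
    using x(3) by (intro eq_vecI) (auto simp: scalar_prod_def lessThan_atLeast0)
  ultimately show "eigenvalue (mat n n (\<lambda>(i, j). M i j)) k"
    unfolding eigenvalue_def eigenvector_def by (intro exI[of _ "vec n x"]) auto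
qed

lemma finite_eigenvalues: "finite {\<mu>. is_eigenvalue n M \<mu>}"
proof -
  define A where "A = mat n n (\<lambda>(i, j). M i j)"
  have "A \<in> carrier_mat n n"
    by (simp add: A_def)
  then have "finite (spectrum A)"
    using card_finite_spectrum(1) by blast
  moreover have "{\<mu>. is_eigenvalue n M \<mu>} = spectrum A"
    unfolding spectrum_def A_def eigenvalue_mat_iff is_eigenvalue_def ..
  ultimately show ?thesis
    by simp
qed

text \<open>A complex eigenvalue exists. The form \<open>q\<close> of its eigenvector equals its own
  conjugate by symmetry, so the eigenvalue is real, and the real or the imaginary part of the
  eigenvector is a nonzero real eigenvector.\<close>

lemma symmetric_has_eigenvalue:
  assumes "n > 0" and symm: "\<And>i j. M i j = M j i"
  shows "\<exists>\<mu>. is_eigenvalue n M \<mu>"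
proof -
  define A where "A = mat n n (\<lambda>(i, j). complex_of_real (M i j))"
  have "spectrum A \<noteq> {}"
    using assms(1) by (intro spectrum_non_empty[of _ n]) (auto simp: A_def)
  then obtain k where "eigenvalue (mat n n (\<lambda>(i, j). complex_of_real (M i j))) k"
    unfolding spectrum_def A_def by blast
  then obtain x :: "nat \<Rightarrow> complex" where "(\<exists>i<n. x i \<noteq> 0) \<and> (\<forall>i<n. (\<Sum>j<n. M i j * x j) = k * x i)"
    unfolding eigenvalue_mat_iff by (rule exE)
  then have x: "\<exists>i<n. x i \<noteq> 0" "\<And>i. i < n \<Longrightarrow> (\<Sum>j<n. M i j * x j) = k * x i"
    by simp_all
  define N where "N = (\<Sum>i<n. (cmod (x i)) ^ 2)"
  have "N > 0"
    using x(1) by (auto simp: N_def intro!: sum_pos2)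
  define q where "q = (\<Sum>i<n. \<Sum>j<n. M i j * (cnj (x i) * x j))"
  have "q = (\<Sum>i<n. cnj (x i) * (\<Sum>j<n. M i j * x j))"
    by (simp add: q_def sum_distrib_left mult_ac)
  also have "\<dots> = (\<Sum>i<n. cnj (x i) * (k * x i))"
    using x(2) by simp
  also have "\<dots> = k * of_real N"
    by (simp add: N_def sum_distrib_left complex_norm_square mult_ac del: of_real_power)
  finally have q: "q = k * of_real N" .
  have "cnj q = q"
    unfolding q_def using symm by (subst sum.swap) (simp add: mult_ac)
  then have "Im k = 0"
    using q \<open>N > 0\<close> by (auto simp: complex_eq_iff)
  have re: "(\<Sum>j<n. M i j * Re (x j)) = Re k * Re (x i)" if "i < n" for i
    using arg_cong[OF x(2)[OF that], of Re] \<open>Im k = 0\<close> by simp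
  have im: "(\<Sum>j<n. M i j * Im (x j)) = Re k * Im (x i)" if "i < n" for i
    using arg_cong[OF x(2)[OF that], of Im] \<open>Im k = 0\<close> by simp
  from x(1) obtain i where "i < n" "Re (x i) \<noteq> 0 \<or> Im (x i) \<noteq> 0"
    by (auto simp: complex_eq_iff)
  then have "is_eigenvalue n M (Re k)"
    unfolding is_eigenvalue_def using re im by (metis (no_types))
  then show ?thesis
    by blast
qed

lemma A_alpha_sym: "wf_graph G \<Longrightarrow> A_alpha \<alpha> G i j = A_alpha \<alpha> G j i"
  by (auto simp: A_alpha_def wf_graph_def)

lemma spectral_radius_alpha_ge:
  "is_eigenvalue (fst G) (A_alpha \<alpha> G) \<mu> \<Longrightarrow> \<mu> \<le> spectral_radius_alpha \<alpha> G"
  unfolding spectral_radius_alpha_def by (rule Max_ge[OF finite_eigenvalues]) simp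

lemma spectral_radius_alpha_is_eigenvalue:
  assumes "wf_graph G" "fst G > 0"
  shows "is_eigenvalue (fst G) (A_alpha \<alpha> G) (spectral_radius_alpha \<alpha> G)"
proof -
  have "{\<mu>. is_eigenvalue (fst G) (A_alpha \<alpha> G) \<mu>} \<noteq> {}"
    using symmetric_has_eigenvalue[where M="A_alpha \<alpha> G", OF assms(2) A_alpha_sym[OF assms(1)]] by blast
  from Max_in[OF finite_eigenvalues this] show ?thesis
    by (simp add: spectral_radius_alpha_def)
qed

lemma finite_graphs: "finite {G. wf_graph G \<and> fst G = n \<and> P G}"
proof (rule finite_subset)
  show "{G. wf_graph G \<and> fst G = n \<and> P G} \<subseteq> {n} \<times> Pow ({0..<n} \<times> {0..<n})"
    by (auto simp: wf_graph_def verts_def)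
qed simp

lemma finite_extremal_family:
  "finite (spectral_radius_alpha \<alpha> ` {G. wf_graph G \<and> fst G = n \<and> free_of \<F> G})"
  by (intro finite_imageI finite_graphs)

section \<open>Colourings and chromatic numbers\<close>

lemma proper_colouring_chromatic_number:
  assumes "wf_graph H"
  shows "\<exists>col. proper_colouring H (chromatic_number H) col"
proof -
  have "proper_colouring H (fst H) (\<lambda>i. i)"
    using assms by (auto simp: proper_colouring_def verts_def wf_graph_def)
  then have "\<exists>col. proper_colouring H (fst H) col"
    by (intro exI[of _ "\<lambda>i. i"])
  then show ?thesis
    unfolding chromatic_number_def by (rule LeastI)
qed

lemma chromatic_number_le: "proper_colouring H c f \<Longrightarrow> chromatic_number H \<le> c"
  unfolding chromatic_number_def by (rule Least_le) blast

lemma proper_colouring_pullback: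
  assumes "wf_graph H" "contains G H" "proper_colouring G c h"
  shows "\<exists>col'. proper_colouring H c col'"
proof -
  obtain f where f: "f ` verts H \<subseteq> verts G" "\<And>i j. (i, j) \<in> snd H \<Longrightarrow> (f i, f j) \<in> snd G"
    using assms(2) by (auto simp: contains_def)
  then have "proper_colouring H c (h \<circ> f)"
    using assms(3) by (auto simp: proper_colouring_def)
  then show ?thesis
    by blast
qed

section \<open>Supersaturation\<close>

lemma in_listset_iff: "xs \<in> listset Bs \<longleftrightarrow> list_all2 (\<in>) xs Bs"
  by (induction Bs arbitrary: xs) (auto simp: set_Cons_def list_all2_Cons2)

text \<open>Used to read off adjacency: once all words of a box have an edge between positions
  \<open>a\<close> and \<open>b\<close>, every pair from the two sides occurs in such a
  word.\<close>

lemma listset_two_entries: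
  assumes "length Bs = m" "\<forall>B\<in>set Bs. B \<noteq> {}" "a < m" "b < m" "a \<noteq> b" "u \<in> Bs ! a" "v \<in> Bs ! b"
  shows "\<exists>xs\<in>listset Bs. xs ! a = u \<and> xs ! b = v"
proof -
  define xs where "xs = map (\<lambda>i. if i = a then u else if i = b then v else SOME z. z \<in> Bs ! i) [0..<m]"
  have "xs \<in> listset Bs"
    using assms unfolding in_listset_iff list_all2_conv_all_nth
    by (auto simp: xs_def some_in_eq)
  moreover have "xs ! a = u" "xs ! b = v"
    using assms(3-5) by (auto simp: xs_def)
  ultimately show ?thesis
    by blast
qed

section \<open>Averaging the kernel over samples\<close>

lemma excess_kernel_le:
  assumes "0 \<le> \<alpha>" "\<alpha> \<le> 1" "0 \<le> \<beta>" "\<And>i. 0 \<le> y i" "\<And>i. y i \<le> M"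
  shows "excess_kernel \<alpha> \<beta> E y i j \<le> M ^ 2"
proof -
  have prod: "y k * y l \<le> M ^ 2" for k l
    unfolding power2_eq_square using assms(4,5) by (meson mult_mono order_trans)
  have "(1 - \<alpha>) * (y i * y j) + \<alpha> * ((y i ^ 2 + y j ^ 2) / 2) \<le> (1 - \<alpha>) * M ^ 2 + \<alpha> * M ^ 2"
    using assms(1,2) prod[of i j] prod[of i i] prod[of j j]
    by (intro add_mono mult_left_mono) (auto simp: power2_eq_square)
  moreover have "0 \<le> \<beta> * ((y i ^ 2 + y j ^ 2) / 2)"
    using assms(3) by simp
  moreover have "(1 - \<alpha>) * M ^ 2 + \<alpha> * M ^ 2 = M ^ 2"
    by (simp add: algebra_simps)
  moreover have "0 \<le> M ^ 2"
    by simp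
  ultimately show ?thesis
    unfolding excess_kernel_def by (simp only: split: if_split) linarith
qed

lemma excess_kernel_diag_ge:
  assumes "(i, i) \<notin> E" "0 \<le> \<beta>" "\<beta> \<le> 1" "0 \<le> y i" "y i \<le> M"
  shows "- (M ^ 2) \<le> excess_kernel \<alpha> \<beta> E y i i"
proof -
  have "\<beta> * y i ^ 2 \<le> 1 * M ^ 2"
    using assms by (intro mult_mono power_mono) auto
  then show ?thesis
    using assms(1) by (simp add: excess_kernel_def)
qed

text \<open>On average each of the \<open>m * (m - 1)\<close> pairs of different positions
  contributes at least \<epsilon>, while each of the \<open>m\<close> diagonal pairs costs at most
  \<open>M ^ 2\<close>. The choice of \<open>m\<close> leaves an average of at least
  \<open>m\<close>, hence at least 1.\<close>

lemma sum_words_excess_ge: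
  assumes "finite V" "V \<noteq> {}" "\<And>i. (i, i) \<notin> E" "0 \<le> \<beta>" "\<beta> \<le> 1"
    and y: "\<And>i. 0 \<le> y i" "\<And>i. y i \<le> M"
    and total: "\<epsilon> * real (card V) ^ 2 \<le> (\<Sum>i\<in>V. \<Sum>j\<in>V. excess_kernel \<alpha> \<beta> E y i j)"
    and m: "M ^ 2 + 1 + \<epsilon> \<le> \<epsilon> * real m" "m > 0"
  shows "real (card V) ^ m
    \<le> (\<Sum>xs\<in>words V m. \<Sum>a<m. \<Sum>b<m. excess_kernel \<alpha> \<beta> E y (xs ! a) (xs ! b))"
proof -
  define g where "g = excess_kernel \<alpha> \<beta> E y"
  define n where "n = real (card V)"
  have n: "n > 0"
    using assms(1,2) by (simp add: n_def card_gt_0_iff)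
  have pair: "n ^ m * (\<epsilon> + (if a = b then - (M ^ 2) - \<epsilon> else 0)) \<le> (\<Sum>xs\<in>words V m. g (xs ! a) (xs ! b))"
    if ab: "a < m" "b < m" for a b
  proof (cases "a = b")
    case True
    have "(\<Sum>xs\<in>words V m. - (M ^ 2)) \<le> (\<Sum>xs\<in>words V m. g (xs ! a) (xs ! b))"
      unfolding g_def True using excess_kernel_diag_ge[OF assms(3-5) y] by (intro sum_mono)
    moreover have "(\<Sum>xs\<in>words V m. - (M ^ 2)) = n ^ m * - (M ^ 2)"
      unfolding sum_constant card_lists_length_eq[OF assms(1)] n_def by simp
    moreover have "n ^ m * (\<epsilon> + (if a = b then - (M ^ 2) - \<epsilon> else 0)) = n ^ m * - (M ^ 2)"
      using True by simp
    ultimately show ?thesis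
      by linarith
  next
    case False
    have "n ^ m * (\<epsilon> * n ^ 2) \<le> n ^ 2 * (\<Sum>xs\<in>words V m. g (xs ! a) (xs ! b))"
      using sum_words_nth_nth[OF assms(1) ab False, of g] total n
      by (simp add: g_def n_def)
    then have "n ^ 2 * (n ^ m * \<epsilon>) \<le> n ^ 2 * (\<Sum>xs\<in>words V m. g (xs ! a) (xs ! b))"
      by (simp add: mult_ac)
    then show ?thesis
      using n False by simp
  qed
  have "1 \<le> real m * (real m * \<epsilon> - M ^ 2 - \<epsilon>)"
  proof -
    have "1 * 1 \<le> real m * (real m * \<epsilon> - M ^ 2 - \<epsilon>)"
      using m by (intro mult_mono) (auto simp: algebra_simps)
    then show ?thesis
      by simp
  qed
  then have "n ^ m * 1 \<le> n ^ m * (real m * (real m * \<epsilon> - M ^ 2 - \<epsilon>))"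
    using n by (intro mult_left_mono) auto
  also have "\<dots> = (\<Sum>a<m. \<Sum>b<m. n ^ m * (\<epsilon> + (if a = b then - (M ^ 2) - \<epsilon> else 0)))"
    by (simp add: sum.distrib algebra_simps flip: sum_distrib_left)
  also have "\<dots> \<le> (\<Sum>a<m. \<Sum>b<m. \<Sum>xs\<in>words V m. g (xs ! a) (xs ! b))"
    using pair by (intro sum_mono) auto
  also have "\<dots> = (\<Sum>a<m. \<Sum>xs\<in>words V m. \<Sum>b<m. g (xs ! a) (xs ! b))"
    by (intro sum.cong[OF refl] sum.swap)
  also have "\<dots> = (\<Sum>xs\<in>words V m. \<Sum>a<m. \<Sum>b<m. g (xs ! a) (xs ! b))"
    by (rule sum.swap)
  finally show ?thesis
    by (simp add: g_def n_def)
qed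

abbreviation clique_words :: "('a \<times> 'a) set \<Rightarrow> 'a set \<Rightarrow> nat \<Rightarrow> nat set \<Rightarrow> 'a list set" where
  "clique_words E V m C \<equiv> {xs \<in> words V m. \<forall>a\<in>C. \<forall>b\<in>C. a \<noteq> b \<longrightarrow> (xs ! a, xs ! b) \<in> E}"

text \<open>Words without a clique on \<open>r + 1\<close> positions contribute at most 0 and all
  others at most \<open>m ^ 2 * M ^ 2\<close>, so the latter are numerous. Pigeonhole over the at
  most \<open>2 ^ m\<close> sets of positions fixes where the clique sits.\<close>

lemma excess_gives_many_clique_words:
  assumes r: "r > 0" and \<alpha>: "0 \<le> \<alpha>" "\<alpha> \<le> 1 - 1 / real r"
    and V: "finite V" "V \<noteq> {}" and E: "sym E" "\<And>i. (i, i) \<notin> E"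
    and y: "\<And>i. 0 \<le> y i" "\<And>i. y i \<le> M" and "M > 0"
    and total: "\<epsilon> * real (card V) ^ 2 \<le> (\<Sum>i\<in>V. \<Sum>j\<in>V. excess_kernel \<alpha> (1 - 1 / real r) E y i j)"
    and m: "M ^ 2 + 1 + \<epsilon> \<le> \<epsilon> * real m" "m > 0"
  shows "\<exists>C\<subseteq>{..<m}. card C = r + 1
    \<and> real (card V) ^ m / (2 * 2 ^ m * real m ^ 2 * M ^ 2) \<le> real (card (clique_words E V m C))"
proof (rule ccontr)
  assume contra: "\<not> ?thesis"
  define n where "n = real (card V)"
  have n: "n > 0"
    using V by (simp add: n_def card_gt_0_iff)
  define \<beta> where "\<beta> = 1 - 1 / real r"
  have \<beta>: "0 \<le> \<beta>" "\<beta> \<le> 1"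
    using r by (auto simp: \<beta>_def field_simps)
  have \<alpha>1: "\<alpha> \<le> 1"
    using \<alpha>(2) \<beta>(2) unfolding \<beta>_def by linarith
  define \<C> where "\<C> = {C. C \<subseteq> {..<m} \<and> card C = r + 1}"
  have \<C>: "finite \<C>" "card \<C> \<le> 2 ^ m"
  proof -
    have sub: "\<C> \<subseteq> Pow {..<m}"
      by (auto simp: \<C>_def)
    then show "finite \<C>"
      by (rule finite_subset) simp
    show "card \<C> \<le> 2 ^ m"
      using card_mono[OF _ sub] by (simp add: card_Pow)
  qed
  define T where "T = (\<Union>C\<in>\<C>. clique_words E V m C)"
  have T: "T \<subseteq> words V m"
    by (auto simp: T_def)
  define F where "F xs = (\<Sum>a<m. \<Sum>b<m. excess_kernel \<alpha> \<beta> E y (xs ! a) (xs ! b))" for xs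
  have "n ^ m \<le> (\<Sum>xs\<in>words V m. F xs)"
    unfolding F_def n_def using sum_words_excess_ge[OF V E(2) \<beta> y _ m] total
    by (simp add: \<beta>_def)
  also have "\<dots> \<le> (\<Sum>xs\<in>words V m. if xs \<in> T then real m ^ 2 * M ^ 2 else 0)"
  proof (rule sum_mono)
    fix xs assume xs: "xs \<in> words V m"
    have "F xs \<le> (\<Sum>a<m. \<Sum>b<m. M ^ 2)"
      unfolding F_def using excess_kernel_le[OF \<alpha>(1) \<alpha>1 \<beta>(1) y] by (intro sum_mono)
    then have "F xs \<le> real m ^ 2 * M ^ 2"
      by (simp add: power2_eq_square mult.assoc)
    moreover have "F xs \<le> 0" if "xs \<notin> T"
      unfolding F_def \<beta>_def
    proof (rule excess_kernel_sum_nonpos[OF _ r \<alpha>(2) E])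
      show "\<not> (\<exists>C\<subseteq>{..<m}. card C = r + 1 \<and> (\<forall>i\<in>C. \<forall>j\<in>C. i \<noteq> j \<longrightarrow> (xs ! i, xs ! j) \<in> E))"
        using that xs by (auto simp: T_def \<C>_def)
    qed simp
    ultimately show "F xs \<le> (if xs \<in> T then real m ^ 2 * M ^ 2 else 0)"
      by simp
  qed
  also have "\<dots> = real (card T) * (real m ^ 2 * M ^ 2)"
    using T V(1) by (simp add: sum.If_cases Int_absorb1)
  finally have lower: "n ^ m \<le> real (card T) * (real m ^ 2 * M ^ 2)" .
  \<comment> \<open>The factor 2 in the denominator makes the upper bound below equal to
    \<open>n ^ m / 2\<close>, which contradicts \<open>lower\<close> strictly.\<close>
  define c where "c = n ^ m / (2 * 2 ^ m * real m ^ 2 * M ^ 2)"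
  have c: "c > 0"
    using n m(2) \<open>M > 0\<close> by (simp add: c_def)
  have "card T \<le> (\<Sum>C\<in>\<C>. card (clique_words E V m C))"
    unfolding T_def by (rule card_UN_le[OF \<C>(1)])
  then have "real (card T) \<le> (\<Sum>C\<in>\<C>. real (card (clique_words E V m C)))"
    by (simp only: of_nat_sum[symmetric] of_nat_le_iff)
  also have "\<dots> \<le> real (card \<C>) * c"
    using contra by (intro sum_bounded_above) (force simp: \<C>_def c_def n_def)
  also have "\<dots> \<le> 2 ^ m * c"
    using of_nat_mono[OF \<C>(2), where 'a = real] c by (intro mult_right_mono) auto
  finally have "real (card T) * (real m ^ 2 * M ^ 2) \<le> 2 ^ m * c * (real m ^ 2 * M ^ 2)"
    by (intro mult_right_mono) auto
  also have "\<dots> = n ^ m / 2"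
    using m(2) \<open>M > 0\<close> by (simp add: c_def)
  finally show False
    using lower zero_less_power[OF n, of m] by linarith
qed

text \<open>The sample size \<open>m\<close> and the density \<open>c\<close> depend only on
  \<epsilon> and \<open>M\<close>, so one threshold \<open>N\<close> serves all \<open>V\<close>,
  \<open>E\<close> and \<open>y\<close>. The parts are the sides of a box at the clique
  positions.\<close>

lemma excess_gives_complete_multipartite:
  fixes \<epsilon> M :: real
  assumes r: "r > 0" and \<alpha>: "0 \<le> \<alpha>" "\<alpha> \<le> 1 - 1 / real r" and "\<epsilon> > 0" "M > 0" "t > 0"
  shows "\<exists>N. \<forall>(V :: 'a set) E y. finite V \<longrightarrow> N \<le> card V \<longrightarrow> sym E \<longrightarrow> (\<forall>i. (i, i) \<notin> E)
    \<longrightarrow> (\<forall>i. 0 \<le> y i \<and> y i \<le> M)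
    \<longrightarrow> \<epsilon> * real (card V) ^ 2 \<le> (\<Sum>i\<in>V. \<Sum>j\<in>V. excess_kernel \<alpha> (1 - 1 / real r) E y i j)
    \<longrightarrow> (\<exists>B. (\<forall>i<r + 1. B i \<subseteq> V \<and> card (B i) = t)
      \<and> (\<forall>i<r + 1. \<forall>j<r + 1. i \<noteq> j \<longrightarrow> B i \<times> B j \<subseteq> E))"
proof -
  obtain m :: nat where "(M ^ 2 + 1 + \<epsilon>) / \<epsilon> < real m"
    using reals_Archimedean2 by blast
  moreover have "0 < (M ^ 2 + 1 + \<epsilon>) / \<epsilon>"
    using assms(4) by (simp add: add_nonneg_pos)
  ultimately have m: "M ^ 2 + 1 + \<epsilon> \<le> \<epsilon> * real m" "m > 0"
    using assms(4) by (auto simp: field_simps intro!: gr0I)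
  define c where "c = 1 / (2 * 2 ^ m * real m ^ 2 * M ^ 2)"
  have "c > 0"
    using m(2) assms(5) by (simp add: c_def)
  from dense_words_contain_box[OF this, of m t] obtain N where N: "\<And>V T. finite V \<Longrightarrow> N \<le> card V
    \<Longrightarrow> T \<subseteq> words (V :: 'a set) m \<Longrightarrow> c * real (card V) ^ m \<le> real (card T)
    \<Longrightarrow> \<exists>Bs. length Bs = m \<and> (\<forall>B\<in>set Bs. B \<subseteq> V \<and> card B = t) \<and> listset Bs \<subseteq> T"
    by blast
  show ?thesis
  proof (intro exI[of _ "max 1 N"] allI impI)
    fix V :: "'a set" and E y
    assume V: "finite V" "max 1 N \<le> card V" and E: "sym E" "\<forall>i. (i, i) \<notin> E"
      and y: "\<forall>i. 0 \<le> y i \<and> y i \<le> M"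
      and total: "\<epsilon> * real (card V) ^ 2 \<le> (\<Sum>i\<in>V. \<Sum>j\<in>V. excess_kernel \<alpha> (1 - 1 / real r) E y i j)"
    have "V \<noteq> {}"
      using V(2) by auto
    then obtain C where C: "C \<subseteq> {..<m}" "card C = r + 1"
      "real (card V) ^ m / (2 * 2 ^ m * real m ^ 2 * M ^ 2) \<le> real (card (clique_words E V m C))"
      using excess_gives_many_clique_words[OF r \<alpha> V(1) _ E(1) _ _ _ assms(5) total m] E(2) y
      by blast
    have "clique_words E V m C \<subseteq> words V m"
      by auto
    then obtain Bs where Bs: "length Bs = m" "\<forall>B\<in>set Bs. B \<subseteq> V \<and> card B = t"
      "listset Bs \<subseteq> clique_words E V m C"
      using N[OF V(1), of "clique_words E V m C"] V(2) C(3) by (auto simp: c_def)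
    \<comment> \<open>Enumerates the clique positions, so that the parts can be indexed by 0 to
      \<open>r\<close>.\<close>
    obtain h where h: "bij_betw h {0..<r + 1} C"
      using ex_bij_betw_nat_finite[of C] C(1,2) by (metis finite_lessThan finite_subset)
    have hC: "h i \<in> C" "h i < m" if "i < r + 1" for i
      using bij_betwE[OF h] that C(1) by (auto simp: subset_iff)
    have ne: "\<forall>B\<in>set Bs. B \<noteq> {}"
      using Bs(2) assms(6) by auto
    have "Bs ! h i \<times> Bs ! h j \<subseteq> E" if ij: "i < r + 1" "j < r + 1" "i \<noteq> j" for i j
    proof clarify
      fix u v assume uv: "u \<in> Bs ! h i" "v \<in> Bs ! h j"
      have "h i \<noteq> h j"
        using h ij by (auto simp: bij_betw_def inj_on_def)
      then obtain xs where "xs \<in> listset Bs" "xs ! h i = u" "xs ! h j = v"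
        using listset_two_entries[OF Bs(1) ne] hC ij uv by blast
      then show "(u, v) \<in> E"
        using Bs(3) hC(1) ij(1,2) \<open>h i \<noteq> h j\<close> by blast
    qed
    then show "\<exists>B. (\<forall>i<r + 1. B i \<subseteq> V \<and> card (B i) = t)
        \<and> (\<forall>i<r + 1. \<forall>j<r + 1. i \<noteq> j \<longrightarrow> B i \<times> B j \<subseteq> E)"
      using Bs(1,2) hC(2) by (intro exI[of _ "\<lambda>i. Bs ! h i"]) auto
  qed
qed

section \<open>Spectral extremal bounds\<close>

text \<open>A vertex of colour \<open>i\<close> is sent into \<open>B i\<close>. Each part is as
  large as the whole vertex set of \<open>H\<close>, so one bijection per part suffices whatever the
  sizes of the colour classes; distinct parts are disjoint because \<open>G\<close> has no
  loops.\<close>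

lemma blowup_contains:
  assumes "wf_graph G" "wf_graph H" "proper_colouring H k h"
    and B: "\<And>i. i < k \<Longrightarrow> B i \<subseteq> verts G" "\<And>i. i < k \<Longrightarrow> card (B i) = fst H"
    and adj: "\<And>i j. i < k \<Longrightarrow> j < k \<Longrightarrow> i \<noteq> j \<Longrightarrow> B i \<times> B j \<subseteq> snd G"
  shows "contains G H"
proof -
  have "\<exists>e. bij_betw e (verts H) (B i)" if "i < k" for i
  proof -
    have "finite (B i)"
      using B(1)[OF that] by (rule finite_subset) (simp add: verts_def)
    then show ?thesis
      using ex_bij_betw_nat_finite[of "B i"] B(2)[OF that] by (simp add: verts_def)
  qed
  then obtain e where e: "\<And>i. i < k \<Longrightarrow> bij_betw (e i) (verts H) (B i)"
    by metis
  have h: "h v < k" if "v \<in> verts H" for v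
    using assms(3) that by (auto simp: proper_colouring_def)
  have eB: "e (h v) v \<in> B (h v)" if "v \<in> verts H" for v
    using bij_betwE[OF e[OF h[OF that]]] that by blast
  have "inj_on (\<lambda>v. e (h v) v) (verts H)"
  proof (rule inj_onI)
    fix u v assume uv: "u \<in> verts H" "v \<in> verts H" "e (h u) u = e (h v) v"
    have "h u = h v"
    proof (rule ccontr)
      assume "h u \<noteq> h v"
      then have "(e (h u) u, e (h v) v) \<in> snd G"
        using adj[OF h[OF uv(1)] h[OF uv(2)]] eB uv(1,2) by blast
      then show False
        using uv(3) assms(1) by (auto simp: wf_graph_def)
    qed
    then show "u = v"
      using uv bij_betw_imp_inj_on[OF e[OF h[OF uv(1)]]] by (auto simp: inj_on_def)
  qed
  moreover have "(\<lambda>v. e (h v) v) ` verts H \<subseteq> verts G"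
    using eB h B(1) by blast
  moreover have "(e (h u) u, e (h v) v) \<in> snd G" if "(u, v) \<in> snd H" for u v
  proof -
    have uv: "u \<in> verts H" "v \<in> verts H" "h u \<noteq> h v"
      using that assms(2,3) by (auto simp: wf_graph_def proper_colouring_def)
    then show ?thesis
      using adj[OF h[OF uv(1)] h[OF uv(2)]] eB by blast
  qed
  ultimately show ?thesis
    unfolding contains_def by (intro exI[of _ "\<lambda>v. e (h v) v"]) blast
qed

section \<open>Upper bound from a large eigenvalue\<close>

lemma degree_eq_sum:
  "real (Defs.degree G i) = (\<Sum>j<fst G. if (i, j) \<in> snd G then 1 else 0)"
  unfolding Defs.degree_def verts_def
  by (simp add: sum.If_cases Int_def lessThan_atLeast0)

lemma degree_le: "Defs.degree G i \<le> fst G"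
proof -
  have "Defs.degree G i \<le> card (verts G)"
    unfolding Defs.degree_def by (rule card_mono) (auto simp: verts_def)
  then show ?thesis
    by (simp add: verts_def)
qed

lemma A_alpha_mult_vec:
  assumes "i < fst G"
  shows "(\<Sum>j<fst G. A_alpha \<alpha> G i j * x j)
    = \<alpha> * real (Defs.degree G i) * x i + (1 - \<alpha>) * (\<Sum>j<fst G. if (i, j) \<in> snd G then x j else 0)"
proof -
  have "(\<Sum>j<fst G. A_alpha \<alpha> G i j * x j)
      = (\<Sum>j<fst G. (if i = j then \<alpha> * real (Defs.degree G i) * x j else 0)
          + (1 - \<alpha>) * (if (i, j) \<in> snd G then x j else 0))"
    by (intro sum.cong refl) (auto simp: A_alpha_def algebra_simps)
  then show ?thesis
    using assms by (simp add: sum.distrib flip: sum_distrib_left)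
qed

text \<open>An eigenvector for an eigenvalue exceeding @@ cannot concentrate on few vertices.\<close>

lemma large_eigenvalue_excess:
  assumes "wf_graph G" "fst G > 0" and ev: "is_eigenvalue (fst G) (A_alpha \<alpha> G) \<mu>"
    and large: "(\<beta> + \<epsilon>) * real (fst G) \<le> \<mu>" and \<alpha>: "0 \<le> \<alpha>" "\<alpha> \<le> \<beta>" "\<alpha> \<le> 1" and "\<epsilon> > 0"
  shows "\<exists>y. (\<forall>i. 0 \<le> y i \<and> y i \<le> 1 / \<epsilon>)
    \<and> \<epsilon> * real (fst G) ^ 2 \<le> (\<Sum>i<fst G. \<Sum>j<fst G. excess_kernel \<alpha> \<beta> (snd G) y i j)"
proof -
  define n where "n = fst G"
  define E where "E = snd G"
  define d where "d i = real (Defs.degree G i)" for i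
  have n: "real n > 0"
    using assms(2) by (simp add: n_def)
  obtain x where x: "\<exists>i<n. x i \<noteq> 0"
    "\<And>i. i < n \<Longrightarrow> (\<Sum>j<n. A_alpha \<alpha> G i j * x j) = \<mu> * x i"
    using ev by (auto simp: is_eigenvalue_def n_def)
  define S where "S = (\<Sum>i<n. \<bar>x i\<bar>)"
  have S: "S > 0"
    using x(1) by (auto simp: S_def intro!: sum_pos2)
  \<comment> \<open>Scaled to total \<open>n\<close>. The value 0 outside the vertex set makes the
    bounds on \<open>y\<close> hold for every index.\<close>
  define y where "y i = (if i < n then \<bar>x i\<bar> * (real n / S) else 0)" for i
  have y0: "0 \<le> y i" for i
    using S by (simp add: y_def)
  have sum_y: "(\<Sum>i<n. y i) = real n"
    using S by (simp add: y_def S_def flip: sum_distrib_right sum_divide_distrib)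
  have "\<mu> \<ge> 0"
    using large \<alpha> assms(8) by (smt (verit) mult_nonneg_nonneg of_nat_0_le_iff)
  have row: "\<mu> * y i \<le> \<alpha> * d i * y i + (1 - \<alpha>) * (\<Sum>j<n. if (i, j) \<in> E then y j else 0)"
    if i: "i < n" for i
  proof -
    have "\<mu> * \<bar>x i\<bar> = \<bar>\<mu> * x i\<bar>"
      using \<open>\<mu> \<ge> 0\<close> by (simp add: abs_mult)
    also have "\<mu> * x i = \<alpha> * d i * x i + (1 - \<alpha>) * (\<Sum>j<n. if (i, j) \<in> E then x j else 0)"
      using x(2)[OF i] A_alpha_mult_vec[of i G \<alpha> x] i by (simp add: n_def E_def d_def)
    also have "\<bar>\<dots>\<bar> \<le> \<bar>\<alpha> * d i * x i\<bar> + \<bar>(1 - \<alpha>) * (\<Sum>j<n. if (i, j) \<in> E then x j else 0)\<bar>"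
      by (rule abs_triangle_ineq)
    also have "\<dots> = \<alpha> * d i * \<bar>x i\<bar> + (1 - \<alpha>) * \<bar>\<Sum>j<n. if (i, j) \<in> E then x j else 0\<bar>"
      using \<alpha> by (simp add: abs_mult d_def)
    also have "\<dots> \<le> \<alpha> * d i * \<bar>x i\<bar> + (1 - \<alpha>) * (\<Sum>j<n. if (i, j) \<in> E then \<bar>x j\<bar> else 0)"
      using \<alpha> by (intro add_left_mono mult_left_mono order_trans[OF sum_abs] sum_mono) auto
    finally have "\<mu> * \<bar>x i\<bar> * (real n / S) \<le> (\<alpha> * d i * \<bar>x i\<bar>
        + (1 - \<alpha>) * (\<Sum>j<n. if (i, j) \<in> E then \<bar>x j\<bar> else 0)) * (real n / S)"
      using S by (intro mult_right_mono) auto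
    moreover have "(\<Sum>j<n. if (i, j) \<in> E then y j else 0)
        = (\<Sum>j<n. if (i, j) \<in> E then \<bar>x j\<bar> else 0) * (real n / S)"
      unfolding sum_distrib_right by (intro sum.cong) (auto simp: y_def)
    ultimately show ?thesis
      using i by (simp add: y_def distrib_right mult.assoc add_divide_distrib)
  qed
  \<comment> \<open>By \<open>row\<close>, \<open>(\<beta> + \<epsilon>) * n * y i\<close> is at
    most \<open>\<beta> * n * y i + n\<close>: the degree term uses \<alpha> \<le> \<beta> and the
    neighbour sum is at most the total \<open>n\<close>.\<close>
  have y1: "y i \<le> 1 / \<epsilon>" for i
  proof (cases "i < n")
    case True
    have "(1 - \<alpha>) * (\<Sum>j<n. if (i, j) \<in> E then y j else 0) \<le> 1 * (\<Sum>j<n. y j)"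
      using \<alpha> y0 by (intro mult_mono sum_mono sum_nonneg) auto
    moreover have "\<alpha> * d i * y i \<le> \<beta> * real n * y i"
      using \<alpha> y0 degree_le[of G i] by (intro mult_right_mono mult_mono) (auto simp: d_def n_def)
    moreover have "(\<beta> + \<epsilon>) * real n * y i \<le> \<mu> * y i"
      using large y0 by (intro mult_right_mono) (auto simp: n_def)
    ultimately have "\<epsilon> * y i * real n \<le> 1 * real n"
      using row[OF True] sum_y by (simp add: algebra_simps)
    then have "\<epsilon> * y i \<le> 1"
      using n by (simp only: mult_le_cancel_right_pos)
    then show ?thesis
      using assms(8) by (simp add: field_simps)
  qed (use assms(8) in \<open>simp add: y_def\<close>)
  define Q where "Q = (\<Sum>i<n. y i ^ 2)"
  \<comment> \<open>Cauchy-Schwarz. The resulting bound \<open>Q \<ge> n\<close> turns the excess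
    \<open>\<epsilon> * n * Q\<close> into one of order \<open>n ^ 2\<close>.\<close>
  have "real n ^ 2 \<le> Q * real n"
    using sum_squared_le_sum_of_squares[of y "{..<n}"] sum_y by (simp add: Q_def)
  then have Q: "real n \<le> Q"
    using n by (simp add: power2_eq_square)
  define R where "R = (\<Sum>i<n. \<Sum>j<n. if (i, j) \<in> E then y i ^ 2 else 0)"
  define P where "P = (\<Sum>i<n. \<Sum>j<n. if (i, j) \<in> E then y i * y j else 0)"
  have "\<mu> * Q = (\<Sum>i<n. (\<mu> * y i) * y i)"
    by (simp add: Q_def sum_distrib_left power2_eq_square mult.assoc)
  also have "\<dots> \<le> (\<Sum>i<n. (\<alpha> * d i * y i + (1 - \<alpha>) * (\<Sum>j<n. if (i, j) \<in> E then y j else 0)) * y i)"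
    using row y0 by (intro sum_mono mult_right_mono) auto
  also have "\<dots> = (\<Sum>i<n. \<alpha> * (\<Sum>j<n. if (i, j) \<in> E then y i ^ 2 else 0)
      + (1 - \<alpha>) * (\<Sum>j<n. if (i, j) \<in> E then y i * y j else 0))"
  proof (rule sum.cong[OF refl])
    fix i
    have "d i * y i ^ 2 = (\<Sum>j<n. if (i, j) \<in> E then y i ^ 2 else 0)"
      unfolding d_def degree_eq_sum sum_distrib_right n_def E_def by (intro sum.cong) auto
    moreover have "(\<Sum>j<n. if (i, j) \<in> E then y j else 0) * y i
        = (\<Sum>j<n. if (i, j) \<in> E then y i * y j else 0)"
      unfolding sum_distrib_right by (intro sum.cong) auto
    ultimately show "(\<alpha> * d i * y i + (1 - \<alpha>) * (\<Sum>j<n. if (i, j) \<in> E then y j else 0)) * y i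
      = \<alpha> * (\<Sum>j<n. if (i, j) \<in> E then y i ^ 2 else 0)
        + (1 - \<alpha>) * (\<Sum>j<n. if (i, j) \<in> E then y i * y j else 0)"
      by (simp add: distrib_right mult.assoc power2_eq_square)
  qed
  also have "\<dots> = \<alpha> * R + (1 - \<alpha>) * P"
    by (simp add: R_def P_def sum.distrib sum_distrib_left)
  finally have form: "\<mu> * Q \<le> \<alpha> * R + (1 - \<alpha>) * P" .
  \<comment> \<open>By symmetry of \<open>E\<close>, the squares at either end of the edges have the
    same sum, so the averaged squares in the kernel again give \<open>R\<close>.\<close>
  have R': "R = (\<Sum>i<n. \<Sum>j<n. if (i, j) \<in> E then y j ^ 2 else 0)"
    unfolding R_def
  proof (subst sum.swap, intro sum.cong refl)
    fix i j
    show "(if (j, i) \<in> E then y j ^ 2 else 0) = (if (i, j) \<in> E then y j ^ 2 else 0)"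
      using assms(1) by (auto simp: wf_graph_def E_def)
  qed
  have "(\<Sum>i<n. \<Sum>j<n. excess_kernel \<alpha> \<beta> E y i j)
      = (\<Sum>i<n. \<Sum>j<n. (1 - \<alpha>) * (if (i, j) \<in> E then y i * y j else 0)
          + \<alpha> / 2 * (if (i, j) \<in> E then y i ^ 2 else 0) + \<alpha> / 2 * (if (i, j) \<in> E then y j ^ 2 else 0)
          - (\<beta> / 2 * y i ^ 2 + \<beta> / 2 * y j ^ 2))"
    by (intro sum.cong refl) (auto simp: excess_kernel_def algebra_simps add_divide_distrib)
  also have "\<dots> = (1 - \<alpha>) * P + \<alpha> / 2 * R + \<alpha> / 2 * R - (real n * (\<beta> / 2 * Q) + real n * (\<beta> / 2 * Q))"
    unfolding sum_subtractf sum.distrib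
    by (simp only: P_def R_def[symmetric] R'[symmetric] Q_def sum_constant card_lessThan
        flip: sum_distrib_left)
  also have "\<dots> = \<alpha> * R + (1 - \<alpha>) * P - \<beta> * real n * Q"
    by simp
  finally have "(\<Sum>i<n. \<Sum>j<n. excess_kernel \<alpha> \<beta> E y i j) = \<alpha> * R + (1 - \<alpha>) * P - \<beta> * real n * Q" .
  moreover have "\<epsilon> * real n * real n \<le> \<epsilon> * real n * Q"
    using Q assms(8) by (intro mult_left_mono) auto
  moreover have "(\<beta> + \<epsilon>) * real n * Q \<le> \<mu> * Q"
    using large Q n by (intro mult_right_mono) (auto simp: n_def)
  ultimately have "\<epsilon> * real n ^ 2 \<le> (\<Sum>i<n. \<Sum>j<n. excess_kernel \<alpha> \<beta> E y i j)"
    using form by (simp add: distrib_right power2_eq_square)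
  then show ?thesis
    using y0 y1 unfolding n_def E_def by blast
qed

text \<open>A larger eigenvalue yields a vector bounded by \<open>1 / \<epsilon>\<close> with
  positive excess, hence a complete \<open>(r + 1)\<close>-partite subgraph with parts of size
  \<open>fst H\<close>, which contains \<open>H\<close>.\<close>

lemma eigenvalue_less_of_not_contains:
  assumes "wf_graph H" "proper_colouring H (r + 1) h" "fst H > 0"
    and r: "r > 0" and \<alpha>: "0 \<le> \<alpha>" "\<alpha> \<le> 1 - 1 / real r" and "\<epsilon> > 0"
  shows "\<exists>N. \<forall>G \<mu>. wf_graph G \<longrightarrow> N \<le> fst G \<longrightarrow> \<not> contains G H
    \<longrightarrow> is_eigenvalue (fst G) (A_alpha \<alpha> G) \<mu> \<longrightarrow> \<mu> < (1 - 1 / real r + \<epsilon>) * real (fst G)"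
proof -
  have "1 / \<epsilon> > 0"
    using assms(7) by simp
  from excess_gives_complete_multipartite[OF r \<alpha> assms(7) this assms(3), where 'a = nat]
  obtain N where N: "\<forall>(V :: nat set) E y. finite V \<longrightarrow> N \<le> card V \<longrightarrow> sym E \<longrightarrow> (\<forall>i. (i, i) \<notin> E)
    \<longrightarrow> (\<forall>i. 0 \<le> y i \<and> y i \<le> 1 / \<epsilon>)
    \<longrightarrow> \<epsilon> * real (card V) ^ 2 \<le> (\<Sum>i\<in>V. \<Sum>j\<in>V. excess_kernel \<alpha> (1 - 1 / real r) E y i j)
    \<longrightarrow> (\<exists>B. (\<forall>i<r + 1. B i \<subseteq> V \<and> card (B i) = fst H)
      \<and> (\<forall>i<r + 1. \<forall>j<r + 1. i \<noteq> j \<longrightarrow> B i \<times> B j \<subseteq> E))"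
    by (rule exE)
  have \<alpha>1: "\<alpha> \<le> 1"
    using \<alpha>(2) r by (smt (verit) divide_nonneg_nonneg of_nat_0_le_iff)
  show ?thesis
  proof (intro exI[of _ "max 1 N"] allI impI)
    fix G \<mu>
    assume G: "wf_graph G" "max 1 N \<le> fst G" "\<not> contains G H"
      and ev: "is_eigenvalue (fst G) (A_alpha \<alpha> G) \<mu>"
    show "\<mu> < (1 - 1 / real r + \<epsilon>) * real (fst G)"
    proof (rule ccontr)
      assume "\<not> ?thesis"
      then obtain y where y: "\<forall>i. 0 \<le> y i \<and> y i \<le> 1 / \<epsilon>"
        "\<epsilon> * real (fst G) ^ 2
          \<le> (\<Sum>i<fst G. \<Sum>j<fst G. excess_kernel \<alpha> (1 - 1 / real r) (snd G) y i j)"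
        using large_eigenvalue_excess[OF G(1) _ ev _ \<alpha> \<alpha>1 assms(7)] G(2) by auto
      have E: "sym (snd G)" "\<forall>i. (i, i) \<notin> snd G"
        using G(1) by (auto simp: wf_graph_def sym_def)
      obtain B where "\<forall>i<r + 1. B i \<subseteq> {..<fst G} \<and> card (B i) = fst H"
        "\<forall>i<r + 1. \<forall>j<r + 1. i \<noteq> j \<longrightarrow> B i \<times> B j \<subseteq> snd G"
        using N[THEN spec, of "{..<fst G}", THEN spec, of "snd G", THEN spec, of y] E y G(2)
        by auto
      then have "contains G H"
        by (intro blowup_contains[OF G(1) assms(1,2), of B]) (auto simp: verts_def lessThan_atLeast0)
      then show False
        using G(3) by simp
    qed
  qed
qed

section \<open>Lower bound construction\<close>

lemma card_residue_class:
  assumes "c < (r :: nat)"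
  shows "card {j. j < r * q \<and> j mod r = c} = q"
proof -
  have "{j. j < r * q \<and> j mod r = c} = (\<lambda>k. k * r + c) ` {..<q}"
  proof (rule subset_antisym; rule subsetI)
    fix j assume j: "j \<in> {j. j < r * q \<and> j mod r = c}"
    then have "j div r < q"
      by (auto simp: less_mult_imp_div_less mult.commute)
    then show "j \<in> (\<lambda>k. k * r + c) ` {..<q}"
      using j by (intro image_eqI[of _ _ "j div r"]) auto
  next
    fix j assume "j \<in> (\<lambda>k. k * r + c) ` {..<q}"
    then obtain k where k: "k < q" "j = k * r + c"
      by auto
    have "j < (k + 1) * r"
      using k assms by simp
    also have "\<dots> \<le> q * r"
      using k by (intro mult_right_mono) auto
    finally show "j \<in> {j. j < r * q \<and> j mod r = c}"
      using k assms by (simp add: mult.commute)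
  qed
  moreover have "inj_on (\<lambda>k. k * r + c) {..<q}"
    using assms by (auto simp: inj_on_def)
  ultimately show ?thesis
    by (simp add: card_image)
qed

text \<open>Equal parts make the indicator vector of the non-isolated vertices an eigenvector.\<close>

definition padded_turan :: "nat \<Rightarrow> nat \<Rightarrow> graph" where
  "padded_turan r n =
    (n, {(i, j). i < r * (n div r) \<and> j < r * (n div r) \<and> i mod r \<noteq> j mod r})"

lemma wf_padded_turan: "wf_graph (padded_turan r n)"
  by (auto simp: wf_graph_def verts_def padded_turan_def
      intro: less_le_trans[OF _ times_div_less_eq_dividend])

text \<open>Residues modulo \<open>r\<close> are a proper colouring, and a copy of \<open>H\<close>
  would inherit these \<open>r\<close> colours.\<close>

lemma padded_turan_free:
  assumes "r > 0" "\<forall>H\<in>\<F>. wf_graph H" "\<forall>H\<in>\<F>. r < chromatic_number H"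
  shows "free_of \<F> (padded_turan r n)"
  unfolding free_of_def
proof (intro ballI notI)
  fix H assume H: "H \<in> \<F>" "contains (padded_turan r n) H"
  have "proper_colouring (padded_turan r n) r (\<lambda>i. i mod r)"
    using assms(1) by (auto simp: proper_colouring_def padded_turan_def)
  then obtain h where "proper_colouring H r h"
    using proper_colouring_pullback H assms(2) by blast
  then show False
    using chromatic_number_le assms(3) H(1) by (meson leD)
qed

lemma padded_turan_eigenvalue:
  assumes "r > 0" "r \<le> n"
  shows "is_eigenvalue n (A_alpha \<alpha> (padded_turan r n)) (real (r - 1) * real (n div r))"
proof -
  define q where "q = n div r"
  define G where "G = padded_turan r n"
  have G: "fst G = n" "snd G = {(i, j). i < r * q \<and> j < r * q \<and> i mod r \<noteq> j mod r}"
    by (auto simp: G_def padded_turan_def q_def)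
  have q: "q > 0" "r * q \<le> n"
    using assms by (auto simp: q_def div_greater_zero_iff)
  define x :: "nat \<Rightarrow> real" where "x i = (if i < r * q then 1 else 0)" for i
  have deg: "Defs.degree G i = (r - 1) * q" if "i < r * q" for i
  proof -
    have "{j \<in> verts G. (i, j) \<in> snd G} = {..<r * q} - {j. j < r * q \<and> j mod r = i mod r}"
      using that q(2) by (auto simp: G verts_def)
    also have "card \<dots> = r * q - q"
      using card_residue_class[of "i mod r" r q] assms(1) by (subst card_Diff_subset) auto
    finally show ?thesis
      by (simp add: Defs.degree_def diff_mult_distrib)
  qed
  have "(\<Sum>j<n. A_alpha \<alpha> G i j * x j) = real (r - 1) * real q * x i" if i: "i < n" for i
  proof -
    have "(\<Sum>j<n. A_alpha \<alpha> G i j * x j) = \<alpha> * real (Defs.degree G i) * x i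
        + (1 - \<alpha>) * (\<Sum>j<n. if (i, j) \<in> snd G then x j else 0)"
      using A_alpha_mult_vec[of i G \<alpha> x] i G(1) by simp
    moreover have "(\<Sum>j<n. if (i, j) \<in> snd G then x j else 0) = real (Defs.degree G i)"
      unfolding degree_eq_sum G(1) by (intro sum.cong) (auto simp: x_def G(2))
    \<comment> \<open>Padding vertices have degree 0. Hence the diagonal and the adjacency part both
      give the degree times \<open>x i\<close>, and \<alpha> cancels.\<close>
    moreover have "real (Defs.degree G i) = real (Defs.degree G i) * x i"
    proof (cases "i < r * q")
      case False
      then have "{j \<in> verts G. (i, j) \<in> snd G} = {}"
        by (auto simp: G(2))
      then have "Defs.degree G i = 0"
        unfolding Defs.degree_def by (simp only: card.empty)
      then show ?thesis
        by simp
    qed (simp add: x_def)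
    ultimately have "(\<Sum>j<n. A_alpha \<alpha> G i j * x j) = real (Defs.degree G i) * x i"
      by (auto simp: algebra_simps)
    then show ?thesis
      using deg by (simp add: x_def)
  qed
  moreover have "x 0 \<noteq> 0" "0 < n"
    using q assms by (auto simp: x_def)
  ultimately show ?thesis
    unfolding is_eigenvalue_def G_def q_def by blast
qed

section \<open>Bounds for the extremal value and the limit\<close>

lemma ex_alpha_ge:
  assumes "r > 0" "r \<le> n" "\<forall>H\<in>\<F>. wf_graph H" "\<forall>H\<in>\<F>. r < chromatic_number H"
  shows "real (r - 1) * real (n div r) \<le> ex_alpha \<alpha> n \<F>"
proof -
  have "fst (padded_turan r n) = n"
    by (simp add: padded_turan_def)
  then have "real (r - 1) * real (n div r) \<le> spectral_radius_alpha \<alpha> (padded_turan r n)"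
    using padded_turan_eigenvalue[OF assms(1,2)] by (intro spectral_radius_alpha_ge) simp
  also have "\<dots> \<le> ex_alpha \<alpha> n \<F>"
    unfolding ex_alpha_def
    using wf_padded_turan padded_turan_free[OF assms(1,3,4)] \<open>fst (padded_turan r n) = n\<close>
    by (intro cSup_upper bdd_above_finite finite_extremal_family) blast
  finally show ?thesis .
qed

text \<open>The padded graph shows that the supremum is over a nonempty set. Since
  \<open>n > 0\<close>, the spectral radius is itself an eigenvalue, so a bound on eigenvalues
  suffices.\<close>

lemma ex_alpha_le:
  assumes "r > 0" "\<forall>H\<in>\<F>. wf_graph H" "\<forall>H\<in>\<F>. r < chromatic_number H" "n > 0"
    and bound: "\<And>G \<mu>. wf_graph G \<Longrightarrow> fst G = n \<Longrightarrow> free_of \<F> G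
      \<Longrightarrow> is_eigenvalue n (A_alpha \<alpha> G) \<mu> \<Longrightarrow> \<mu> \<le> c"
  shows "ex_alpha \<alpha> n \<F> \<le> c"
  unfolding ex_alpha_def
proof (rule cSup_least)
  have "fst (padded_turan r n) = n"
    by (simp add: padded_turan_def)
  then show "spectral_radius_alpha \<alpha> ` {G. wf_graph G \<and> fst G = n \<and> free_of \<F> G} \<noteq> {}"
    using wf_padded_turan padded_turan_free[OF assms(1-3)] by blast
next
  fix \<mu> assume "\<mu> \<in> spectral_radius_alpha \<alpha> ` {G. wf_graph G \<and> fst G = n \<and> free_of \<F> G}"
  then show "\<mu> \<le> c"
    using bound spectral_radius_alpha_is_eigenvalue assms(4) by auto
qed

theorem theorem2p1:
  fixes \<F> :: "graph set" and r :: nat and \<alpha> :: real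
  assumes "\<F> \<noteq> {}"
    and "\<forall>H\<in>\<F>. wf_graph H"
    and "family_chromatic_number \<F> = r + 1"
    and "r + 1 \<ge> 3"
    and "0 \<le> \<alpha>" and "\<alpha> \<le> 1 - 1 / real r"
  shows "(\<lambda>n. ex_alpha \<alpha> n \<F> / real n) \<longlonglongrightarrow> 1 - 1 / real r"
proof -
  have r: "r > 0"
    using assms(4) by simp
  have "Inf (chromatic_number ` \<F>) \<in> chromatic_number ` \<F>"
    using assms(1) by (intro Inf_nat_def1) simp
  then obtain H where H: "H \<in> \<F>" "chromatic_number H = r + 1"
    using assms(3) by (auto simp: family_chromatic_number_def)
  have chi: "\<forall>H\<in>\<F>. r < chromatic_number H"
  proof
    fix H assume "H \<in> \<F>"
    then have "Inf (chromatic_number ` \<F>) \<le> chromatic_number H"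
      by (intro cInf_lower) auto
    then show "r < chromatic_number H"
      using assms(3) by (simp add: family_chromatic_number_def)
  qed
  have wf_H: "wf_graph H"
    using assms(2) H(1) by simp
  then obtain h where h: "proper_colouring H (r + 1) h"
    using proper_colouring_chromatic_number H(2) by metis
  \<comment> \<open>A graph without vertices would be coloured with 0 colours. Positivity is
    required because \<open>fst H\<close> becomes the part size.\<close>
  have "fst H > 0"
  proof (rule ccontr)
    assume "\<not> fst H > 0"
    then have "proper_colouring H 0 h"
      using wf_H by (auto simp: proper_colouring_def wf_graph_def verts_def)
    then show False
      using chromatic_number_le H(2) by fastforce
  qed
  show ?thesis
  proof (rule tendstoI)
    fix e :: real assume e: "e > 0"
    then have "e / 2 > 0"
      by simp
    from eigenvalue_less_of_not_contains[OF wf_H h \<open>fst H > 0\<close> r assms(5,6) this]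
    obtain N where N: "\<And>G \<mu>. wf_graph G \<Longrightarrow> N \<le> fst G \<Longrightarrow> \<not> contains G H
      \<Longrightarrow> is_eigenvalue (fst G) (A_alpha \<alpha> G) \<mu> \<Longrightarrow> \<mu> < (1 - 1 / real r + e / 2) * real (fst G)"
      by blast
    \<comment> \<open>Rounding \<open>n / r\<close> down to \<open>n div r\<close> costs at most
      \<open>(r - 1) / n\<close> after division by \<open>n\<close>; this threshold makes the loss
      smaller than \<open>e\<close>.\<close>
    obtain N' :: nat where N': "real r / e < real N'"
      using reals_Archimedean2 by blast
    show "\<forall>\<^sub>F n in sequentially. dist (ex_alpha \<alpha> n \<F> / real n) (1 - 1 / real r) < e"
      using eventually_ge_at_top[of "max r (max N N')"]
    proof eventually_elim
      case (elim n)
      have n: "real n > 0"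
        using elim r by simp
      have "ex_alpha \<alpha> n \<F> \<le> (1 - 1 / real r + e / 2) * real n"
      proof (rule ex_alpha_le[OF r assms(2) chi])
        show "n > 0"
          using n by simp
        fix G \<mu>
        assume "wf_graph G" "fst G = n" "free_of \<F> G" "is_eigenvalue n (A_alpha \<alpha> G) \<mu>"
        then show "\<mu> \<le> (1 - 1 / real r + e / 2) * real n"
          using N[of G \<mu>] elim H(1) by (auto simp: free_of_def)
      qed
      then have upper: "ex_alpha \<alpha> n \<F> / real n \<le> 1 - 1 / real r + e / 2"
        using n by (simp add: pos_divide_le_eq)
      have "n < r + r * (n div r)"
        by (rule dividend_less_times_div[OF r])
      then have "real n < (1 + real (n div r)) * real r"
        by (metis of_nat_less_iff of_nat_add of_nat_mult of_nat_1 distrib_right mult_1 mult.commute)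
      then have "real n / real r - 1 \<le> real (n div r)"
        using r by (simp add: pos_divide_le_eq diff_le_eq add.commute)
      then have "real (r - 1) * (real n / real r - 1) \<le> real (r - 1) * real (n div r)"
        by (intro mult_left_mono) auto
      also have "\<dots> \<le> ex_alpha \<alpha> n \<F>"
        using elim by (intro ex_alpha_ge[OF r _ assms(2) chi]) simp
      finally have "real (r - 1) * (real n / real r - 1) / real n \<le> ex_alpha \<alpha> n \<F> / real n"
        using n by (intro divide_right_mono) auto
      moreover have "real (r - 1) * (real n / real r - 1) / real n = 1 - 1 / real r - real (r - 1) / real n"
        using n r by (simp add: field_simps of_nat_diff)
      moreover have "real (r - 1) / real n < e"
      proof -
        have "real r / e < real n"
          using N' elim by simp
        then have "real r < e * real n"
          using e by (simp add: pos_divide_less_eq mult.commute)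
        then show ?thesis
          using n by (simp add: pos_divide_less_eq)
      qed
      ultimately show ?case
        using upper e by (simp add: dist_real_def abs_less_iff)
    qed
  qed
qed

end
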